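(* There exists an algorithm that takes a deterministic finite Muller automaton $\mathcal{A}$ over the alphabet $\{0,1\}^d$ and infinite predicates $P_1,\ldots,P_d\subseteq\mathbb{N}$ that are effectively procyclic and effectively sparse (given by oracles for membership $n\in P_i$, for the procyclicity data and for the sparsity data), and outputs a deterministic finite Muller automaton $\mathcal{B}$ such that $\alpha\in L(\mathcal{A})\Leftrightarrow\beta\in L(\mathcal{B})$, where $\alpha$ is the characteristic word and $\beta$ the order word of $P_1,\ldots,P_d$.
   Context: A deterministic finite Muller automaton over $\Sigma$ is $(Q,q_{\mathrm{init}},\delta,\mathcal{F})$ with finite $Q$, $\delta\colon Q\times\Sigma\to Q$, $\mathcal{F}\subseteq 2^Q$; it accepts $\alpha\in\Sigma^\omega$ iff the set of states occurring infinitely often in its run on $\alpha$ belongs to $\mathcal{F}$; $L(\mathcal{A})$ is the set of accepted words. The characteristic word $\alpha\in(\{0,1\}^d)^\omega$ of $P_1,\ldots,P_d$ has $\alpha(n)=(b_1,\ldots,b_d)$ with $b_i=1$ iff $n\in P_i$; the order word is obtained from $\alpha$ by deleting all occurrences of the letter $(0,\ldots,0)$. Enumerate $P_i$ increasingly as $p^{(i)}_0<p^{(i)}_1<\cdots$. The predicates are effectively procyclic if for each $i$ and each $m\ge 1$ one can compute $N$ and $p\ge 1$ with $p^{(i)}_{n+p}\equiv p^{(i)}_n \pmod m$ for all $n\ge N$. They are effectively sparse if for all $i,j$ and $K$, the inequality $0<|p^{(i)}_n-p^{(j)}_m|<K$ has only finitely many solutions $(n,m)$, which can be effectively determined. *)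

theory Defs
  imports
    "HOL-Library.Omega_Words_Fun"
    "HOL-Library.Infinite_Set"
    "HOL-Library.Nat_Bijection"
    "HOL-Number_Theory.Cong"
begin

section \<open>Partial recursive functions relative to oracles\<close>

text \<open>
  The notion of algorithm is Kleene's: programs for the partial recursive functions, extended by
  calls to oracles, which are total functions on tuples of natural numbers named by elements of
  \<^typ>\<open>'o\<close>. Tuples are lists; a program applied to a tuple of the wrong length may simply have no
  value.
\<close>

datatype 'o recprog =
    Zero
  | Succ
  | Proj nat
  | Query 'o
  | Comp "'o recprog" "'o recprog list"
  | PrimRec "'o recprog" "'o recprog"
  | Mu "'o recprog"

inductive computes ::
    "('o \<Rightarrow> nat list \<Rightarrow> nat) \<Rightarrow> 'o recprog \<Rightarrow> nat list \<Rightarrow> nat \<Rightarrow> bool"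
  for orc :: "'o \<Rightarrow> nat list \<Rightarrow> nat"
where
  zero: "computes orc Zero xs 0"
| succ: "computes orc Succ [x] (Suc x)"
| proj: "i < length xs \<Longrightarrow> computes orc (Proj i) xs (xs ! i)"
| query: "computes orc (Query q) xs (orc q xs)"
| comp: "list_all2 (\<lambda>g y. computes orc g xs y) gs ys \<Longrightarrow> computes orc f ys z
    \<Longrightarrow> computes orc (Comp f gs) xs z"
| primrec_0: "computes orc f xs y \<Longrightarrow> computes orc (PrimRec f g) (0 # xs) y"
| primrec_Suc: "computes orc (PrimRec f g) (n # xs) r \<Longrightarrow> computes orc g (n # r # xs) y
    \<Longrightarrow> computes orc (PrimRec f g) (Suc n # xs) y"
| mu: "computes orc f (n # xs) 0 \<Longrightarrow> (\<forall>k<n. \<exists>y. computes orc f (k # xs) (Suc y))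
    \<Longrightarrow> computes orc (Mu f) xs n"

lemma computes_deterministic:
  assumes "computes orc f xs y" and "computes orc f xs z"
  shows "y = z"
  using assms
proof (induction arbitrary: z rule: computes.induct)
  case (zero xs)
  then show ?case by cases auto
next
  case (succ x)
  then show ?case by cases auto
next
  case (proj i xs)
  from proj(2) show ?case by cases auto
next
  case (query q xs)
  then show ?case by cases auto
next
  case (comp xs gs ys f w)
  from comp.prems obtain ys' where
    ys': "list_all2 (\<lambda>g y. computes orc g xs y) gs ys'" and f: "computes orc f ys' z"
    by cases blast
  have "ys = ys'"
  proof (rule nth_equalityI)
    show len: "length ys = length ys'"
      using list_all2_lengthD[OF comp.IH(1)] list_all2_lengthD[OF ys'] by simp
    show "ys ! i = ys' ! i" if "i < length ys" for i
    proof -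
      have "i < length ys'" using that len by simp
      then have "computes orc (gs ! i) xs (ys' ! i)" using ys' by (rule list_all2_nthD2[rotated])
      with list_all2_nthD2[OF comp.IH(1) that] show ?thesis by blast
    qed
  qed
  with comp.IH(2) f show ?case by blast
next
  case (primrec_0 f xs y g)
  from primrec_0.prems have "computes orc f xs z" by cases auto
  with primrec_0.IH show ?case by blast
next
  case (primrec_Suc f g n xs r y)
  from primrec_Suc.prems obtain r' where
    "computes orc (PrimRec f g) (n # xs) r'" and "computes orc g (n # r' # xs) z"
    by cases blast
  with primrec_Suc.IH show ?case by blast
next
  case (mu f n xs)
  from mu.prems have z: "computes orc f (z # xs) 0" by cases auto
  from mu.prems have below: "\<forall>k<z. \<exists>y. computes orc f (k # xs) (Suc y)" by cases auto
  have "\<not> n < z" using below mu.IH(1) by blast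
  moreover have "\<not> z < n" using mu.IH(2) z by blast
  ultimately show ?case by simp
qed


section \<open>Deterministic finite Muller automata\<close>

record ('q, 'a) dma =
  states :: "'q set"
  init :: 'q
  delta :: "'q \<Rightarrow> 'a \<Rightarrow> 'q"
  acc :: "'q set set"

definition dma_over :: "'a set \<Rightarrow> ('q, 'a) dma \<Rightarrow> bool" where
  "dma_over \<Sigma> A \<longleftrightarrow> finite (states A) \<and> init A \<in> states A
     \<and> (\<forall>q\<in>states A. \<forall>a\<in>\<Sigma>. delta A q a \<in> states A) \<and> acc A \<subseteq> Pow (states A)"

primrec dma_run :: "('q, 'a) dma \<Rightarrow> 'a word \<Rightarrow> 'q word" where
  "dma_run A w 0 = init A"
| "dma_run A w (Suc n) = delta A (dma_run A w n) (w n)"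

definition dma_lang :: "'a set \<Rightarrow> ('q, 'a) dma \<Rightarrow> 'a word set" where
  "dma_lang \<Sigma> A = {w. range w \<subseteq> \<Sigma> \<and> limit (dma_run A w) \<in> acc A}"

text \<open>The alphabet $\{0,1\}^d$.\<close>

definition bitvecs :: "nat \<Rightarrow> bool list set" where
  "bitvecs d = {b. length b = d}"

text \<open>
  \<open>presents d c A\<close>: the number \<open>c\<close> codes a finite presentation of \<open>A\<close> as an automaton over
  $\{0,1\}^d$, consisting of a list of its states, the initial state, the transition table and a
  list of the accepting sets, in any order and possibly with repetitions. The values of
  \<open>delta\<close> outside of \<open>states A \<times> bitvecs d\<close> play no role.
\<close>

definition letter_code :: "bool list \<Rightarrow> nat" where
  "letter_code b = list_encode (map of_bool b)"

definition presents :: "nat \<Rightarrow> nat \<Rightarrow> (nat, bool list) dma \<Rightarrow> bool" where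
  "presents d c A \<longleftrightarrow> (\<exists>Qs ts Fs.
     set Qs = states A
   \<and> set ts = {(q, b, delta A q b) | q b. q \<in> states A \<and> b \<in> bitvecs d}
   \<and> set ` set Fs = acc A
   \<and> c = list_encode
       [list_encode Qs,
        init A,
        list_encode (map (\<lambda>(q, b, q'). list_encode [q, letter_code b, q']) ts),
        list_encode (map list_encode Fs)])"

lemma finite_bitvecs: "finite (bitvecs d)"
  using finite_lists_length_eq[of "UNIV :: bool set" d] by (simp add: bitvecs_def)

lemma presents_exists:
  assumes "dma_over (bitvecs d) A"
  shows "\<exists>c. presents d c A"
proof -
  have fin: "finite (states A)" and F: "acc A \<subseteq> Pow (states A)"
    using assms by (simp_all add: dma_over_def)
  have finF: "finite (acc A)" by (rule finite_subset[OF F]) (simp add: fin)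
  have sub: "finite F" if "F \<in> acc A" for F
    using F that by (blast intro: finite_subset[OF _ fin])
  obtain Qs where Qs: "set Qs = states A" using fin finite_list by blast
  have "{(q, b, delta A q b) | q b. q \<in> states A \<and> b \<in> bitvecs d}
      \<subseteq> (\<lambda>(q, b). (q, b, delta A q b)) ` (states A \<times> bitvecs d)"
    by auto
  then have "finite {(q, b, delta A q b) | q b. q \<in> states A \<and> b \<in> bitvecs d}"
    by (rule finite_subset) (intro finite_imageI finite_cartesian_product fin finite_bitvecs)
  from finite_list[OF this]
  obtain ts where ts: "set ts = {(q, b, delta A q b) | q b. q \<in> states A \<and> b \<in> bitvecs d}" ..
  obtain Ss where Ss: "set Ss = acc A" using finF finite_list by blast
  have "set ` set (map sorted_list_of_set Ss) = (\<lambda>F. set (sorted_list_of_set F)) ` acc A"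
    by (simp only: set_map Ss image_image)
  also have "\<dots> = (\<lambda>F. F) ` acc A"
    by (rule image_cong[OF refl]) (rule set_sorted_list_of_set[OF sub])
  finally have Fs: "set ` set (map sorted_list_of_set Ss) = acc A" by simp
  show ?thesis
    unfolding presents_def by (intro exI conjI) (rule Qs ts Fs refl)+
qed


section \<open>Predicates, their words and their oracles\<close>

text \<open>The predicates are \<open>P 0, \<dots>, P (d - 1)\<close>; the increasing enumeration is \<^const>\<open>enumerate\<close>.\<close>

definition char_word :: "nat \<Rightarrow> (nat \<Rightarrow> nat set) \<Rightarrow> bool list word" where
  "char_word d P n = map (\<lambda>i. n \<in> P i) [0..<d]"

text \<open>
  Deleting the zero letters; this is an \<open>\<omega>\<close>-word only if infinitely many letters remain, as is the
  case when some predicate is infinite.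
\<close>

definition order_word :: "nat \<Rightarrow> (nat \<Rightarrow> nat set) \<Rightarrow> bool list word" where
  "order_word d P = char_word d P \<circ> enumerate {n. char_word d P n \<noteq> replicate d False}"

definition procyclicity_data ::
    "nat \<Rightarrow> (nat \<Rightarrow> nat set) \<Rightarrow> (nat \<Rightarrow> nat \<Rightarrow> nat \<times> nat) \<Rightarrow> bool" where
  "procyclicity_data d P pc \<longleftrightarrow> (\<forall>i<d. \<forall>m\<ge>1. case pc i m of (N, p) \<Rightarrow>
     p \<ge> 1 \<and> (\<forall>n\<ge>N. [enumerate (P i) (n + p) = enumerate (P i) n] (mod m)))"

definition sparsity_data ::
    "nat \<Rightarrow> (nat \<Rightarrow> nat set) \<Rightarrow> (nat \<Rightarrow> nat \<Rightarrow> nat \<Rightarrow> (nat \<times> nat) list) \<Rightarrow> bool" where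
  "sparsity_data d P sp \<longleftrightarrow> (\<forall>i<d. \<forall>j<d. \<forall>K. set (sp i j K) =
     {(n, m). 0 < \<bar>int (enumerate (P i) n) - int (enumerate (P j) m)\<bar>
            \<and> \<bar>int (enumerate (P i) n) - int (enumerate (P j) m)\<bar> < int K})"

datatype query = Membership | Procyclicity | Sparsity

fun answer ::
    "(nat \<Rightarrow> nat set) \<Rightarrow> (nat \<Rightarrow> nat \<Rightarrow> nat \<times> nat) \<Rightarrow> (nat \<Rightarrow> nat \<Rightarrow> nat \<Rightarrow> (nat \<times> nat) list)
     \<Rightarrow> query \<Rightarrow> nat list \<Rightarrow> nat" where
  "answer P pc sp Membership [i, n] = of_bool (n \<in> P i)"
| "answer P pc sp Procyclicity [i, m] = prod_encode (pc i m)"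
| "answer P pc sp Sparsity [i, j, K] = list_encode (map prod_encode (sp i j K))"
| "answer P pc sp _ _ = 0"

end

theory Submission
  imports Defs
begin

text \<open>
  Let the code of the given automaton be \<open>c\<close>; it has at most \<open>c\<close> states, so reading \<open>0^g\<close> with
  \<open>g \<ge> c\<close> has an effect that depends only on \<open>g\<close> modulo \<open>c!\<close>, and visits the whole orbit of the
  current state under the letter \<open>0\<close>. By sparsity all gaps between nonzero letters are longer than
  \<open>c\<close> from some position \<open>X\<close> on, and by procyclicity the residue modulo \<open>c!\<close> of the position of a
  nonzero letter is determined by the number, modulo a common period, of earlier elements of any
  predicate to which it belongs. An automaton reading the order word can keep these counters, and
  thus knows the state of the given automaton after each nonzero letter beyond \<open>X\<close>; the states seen
  infinitely often are the union of the orbits of the states it passes through infinitely often.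

  A suitable \<open>X\<close>, together with a bound \<open>Y\<close> up to which all residues occur, is found by
  unbounded search; everything else is a total function of the data, uniformly computable in the
  oracle answers.
\<close>

section \<open>Total functions computable uniformly in the oracle answers\<close>

text \<open>
  The arguments are given as an environment, so that passing to one more argument is the
  shift \<^term>\<open>\<lambda>i. e (Suc i)\<close>, which is well behaved under beta reduction; the closure rules below can
  therefore be applied by plain resolution.
\<close>

definition recfn :: "nat \<Rightarrow> (('o \<Rightarrow> nat list \<Rightarrow> nat) \<Rightarrow> (nat \<Rightarrow> nat) \<Rightarrow> nat) \<Rightarrow> bool" where
  "recfn k F \<longleftrightarrow> (\<exists>prog. \<forall>orc xs. length xs = k \<longrightarrow> computes orc prog xs (F orc (\<lambda>i. xs ! i)))"

abbreviation recpred :: "nat \<Rightarrow> (('o \<Rightarrow> nat list \<Rightarrow> nat) \<Rightarrow> (nat \<Rightarrow> nat) \<Rightarrow> bool) \<Rightarrow> bool" where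
  "recpred k P \<equiv> recfn k (\<lambda>orc e. of_bool (P orc e))"

section \<open>Projections, composition, constants and oracle calls\<close>

lemma recfn_var: "i < k \<Longrightarrow> recfn k (\<lambda>orc e. e i)"
  unfolding recfn_def using computes.proj by blast

text \<open>Beyond its arity \<open>F\<close> sees whatever \<open>!\<close> yields on a list that
  is too short; keeping the environment in the form \<open>map ... ! i\<close> makes it the very one
  on which the program for \<open>F\<close> is specified.\<close>

lemma recfn_comp:
  assumes F: "recfn (length Gs) F" and Gs: "\<And>G. G \<in> set Gs \<Longrightarrow> recfn k G"
  shows "recfn k (\<lambda>orc e. F orc (\<lambda>i. map (\<lambda>G. G orc e) Gs ! i))"
proof -
  from F obtain f where
    f: "computes orc f xs (F orc (\<lambda>i. xs ! i))" if "length xs = length Gs" for orc xs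
    unfolding recfn_def by blast
  have "\<forall>G\<in>set Gs. \<exists>g. \<forall>orc xs. length xs = k \<longrightarrow> computes orc g xs (G orc (\<lambda>i. xs ! i))"
    using Gs unfolding recfn_def by blast
  then obtain g where
    g: "computes orc (g G) xs (G orc (\<lambda>i. xs ! i))" if "G \<in> set Gs" "length xs = k" for G orc xs
    by metis
  have "computes orc (Comp f (map g Gs)) xs (F orc (\<lambda>i. map (\<lambda>G. G orc (\<lambda>i. xs ! i)) Gs ! i))"
    if "length xs = k" for orc xs
    by (rule computes.comp[OF _ f]) (auto simp: list_all2_conv_all_nth intro: g that)
  then show ?thesis unfolding recfn_def by blast
qed

lemma recfn_comp1:
  assumes "recfn 1 (\<lambda>orc e. f orc (e 0))" "recfn k A1"
  shows "recfn k (\<lambda>orc e. f orc (A1 orc e))"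
proof -
  have "recfn (length [A1]) (\<lambda>orc e. f orc (e 0))" using assms(1) by simp
  from recfn_comp[OF this, of k] assms(2-) show ?thesis by auto
qed

lemma recfn_comp2:
  assumes "recfn 2 (\<lambda>orc e. f orc (e 0) (e 1))" "recfn k A1" "recfn k A2"
  shows "recfn k (\<lambda>orc e. f orc (A1 orc e) (A2 orc e))"
proof -
  have "recfn (length [A1, A2]) (\<lambda>orc e. f orc (e 0) (e 1))"
    using assms(1) by (simp add: numeral_2_eq_2)
  from recfn_comp[OF this, of k] assms(2-) show ?thesis by auto
qed

lemma recfn_comp3:
  assumes "recfn 3 (\<lambda>orc e. f orc (e 0) (e 1) (e 2))" "recfn k A1" "recfn k A2" "recfn k A3"
  shows "recfn k (\<lambda>orc e. f orc (A1 orc e) (A2 orc e) (A3 orc e))"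
proof -
  have "recfn (length [A1, A2, A3]) (\<lambda>orc e. f orc (e 0) (e 1) (e 2))"
    using assms(1) by (simp add: eval_nat_numeral)
  from recfn_comp[OF this, of k] assms(2-) show ?thesis by auto
qed

lemma recfn_comp4:
  assumes "recfn 4 (\<lambda>orc e. f orc (e 0) (e 1) (e 2) (e 3))"
    "recfn k A1" "recfn k A2" "recfn k A3" "recfn k A4"
  shows "recfn k (\<lambda>orc e. f orc (A1 orc e) (A2 orc e) (A3 orc e) (A4 orc e))"
proof -
  have "recfn (length [A1, A2, A3, A4]) (\<lambda>orc e. f orc (e 0) (e 1) (e 2) (e 3))"
    using assms(1) by (simp add: eval_nat_numeral)
  from recfn_comp[OF this, of k] assms(2-) show ?thesis by auto
qed

lemma recfn_comp6:
  assumes "recfn 6 (\<lambda>orc e. f orc (e 0) (e 1) (e 2) (e 3) (e 4) (e 5))"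
    "recfn k A1" "recfn k A2" "recfn k A3" "recfn k A4" "recfn k A5" "recfn k A6"
  shows "recfn k (\<lambda>orc e. f orc (A1 orc e) (A2 orc e) (A3 orc e) (A4 orc e) (A5 orc e) (A6 orc e))"
proof -
  have "recfn (length [A1, A2, A3, A4, A5, A6]) (\<lambda>orc e. f orc (e 0) (e 1) (e 2) (e 3) (e 4) (e 5))"
    using assms(1) by (simp add: eval_nat_numeral)
  from recfn_comp[OF this, of k] assms(2-) show ?thesis by auto
qed

lemma recfn_Suc:
  assumes "recfn k A" shows "recfn k (\<lambda>orc e. Suc (A orc e))"
proof (rule recfn_comp1[where f = "\<lambda>_. Suc", OF _ assms])
  have "computes orc Succ xs (Suc (xs ! 0))" if "length xs = 1" for orc :: "'a \<Rightarrow> nat list \<Rightarrow> nat" and xs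
    using that by (cases xs) (auto intro: computes.succ)
  then show "recfn 1 (\<lambda>(orc :: 'a \<Rightarrow> nat list \<Rightarrow> nat) e. Suc (e 0))"
    unfolding recfn_def by blast
qed

lemma recfn_const: "recfn k (\<lambda>orc e. n)"
proof (induction n)
  case 0
  show ?case unfolding recfn_def using computes.zero by blast
qed (rule recfn_Suc)

lemma recfn_query2:
  assumes "recfn k A" "recfn k B" shows "recfn k (\<lambda>orc e. orc q [A orc e, B orc e])"
proof (rule recfn_comp2[where f = "\<lambda>orc a b. orc q [a, b]", OF _ assms])
  have "computes orc (Query q) xs (orc q [xs ! 0, xs ! 1])" if "length xs = 2" for orc xs
    using that computes.query[of orc q xs] by (auto simp: length_Suc_conv numeral_2_eq_2)
  then show "recfn 2 (\<lambda>orc e. orc q [e 0, e 1])" unfolding recfn_def by blast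
qed

lemma recfn_query3:
  assumes "recfn k A" "recfn k B" "recfn k C"
  shows "recfn k (\<lambda>orc e. orc q [A orc e, B orc e, C orc e])"
proof (rule recfn_comp3[where f = "\<lambda>orc a b c. orc q [a, b, c]", OF _ assms])
  have "computes orc (Query q) xs (orc q [xs ! 0, xs ! 1, xs ! 2])" if "length xs = 3" for orc xs
    using that computes.query[of orc q xs] by (auto simp: length_Suc_conv eval_nat_numeral)
  then show "recfn 3 (\<lambda>orc e. orc q [e 0, e 1, e 2])" unfolding recfn_def by blast
qed

text \<open>Composing with the projections 1 to \<open>k\<close> makes a term available under one
  more binder, whose variable is argument 0.\<close>

lemma recfn_shift:
  assumes "recfn k A" shows "recfn (Suc k) (\<lambda>orc e. A orc (\<lambda>i. e (Suc i)))"
proof -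
  let ?Gs = "map (\<lambda>i orc e. e (Suc i)) [0..<k]"
  have "recfn (length ?Gs) A" using assms by simp
  then have "recfn (Suc k) (\<lambda>orc e. A orc (\<lambda>i. map (\<lambda>G. G orc e) ?Gs ! i))"
    by (rule recfn_comp) (auto intro: recfn_var)
  moreover have "map (\<lambda>i. xs ! Suc i) [0..<k] = tl xs" "(\<lambda>i. xs ! Suc i) = (\<lambda>i. tl xs ! i)"
    if "length xs = Suc k" for xs :: "nat list"
    using that by (cases xs; auto intro: nth_equalityI)+
  ultimately show ?thesis unfolding recfn_def by (simp add: comp_def)
qed

text \<open>Inside a primitive recursion the first two arguments are the counter and the previous
  value. A term with one bound variable is used there by computing that variable as \<open>M\<close>
  from all arguments and dropping these two.\<close>

lemma recfn_subst:
  assumes "recfn (Suc k) (\<lambda>orc e. A orc (e 0) (\<lambda>i. e (Suc i)))" "recfn (Suc (Suc k)) M"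
  shows "recfn (Suc (Suc k)) (\<lambda>orc e. A orc (M orc e) (\<lambda>i. e (Suc (Suc i))))"
proof -
  let ?Gs = "M # map (\<lambda>i orc e. e (Suc (Suc i))) [0..<k]"
  have "recfn (length ?Gs) (\<lambda>orc e. A orc (e 0) (\<lambda>i. e (Suc i)))" using assms(1) by simp
  then have "recfn (Suc (Suc k)) (\<lambda>orc e. A orc (map (\<lambda>G. G orc e) ?Gs ! 0)
      (\<lambda>i. map (\<lambda>G. G orc e) ?Gs ! Suc i))"
    by (rule recfn_comp) (auto intro: recfn_var assms(2))
  moreover have "map (\<lambda>i. xs ! Suc (Suc i)) [0..<k] = tl (tl xs)"
    "(\<lambda>i. xs ! Suc (Suc i)) = (\<lambda>i. tl (tl xs) ! i)"
    if "length xs = Suc (Suc k)" for xs :: "nat list"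
    using that by (cases xs; cases "tl xs"; auto intro: nth_equalityI)+
  ultimately show ?thesis unfolding recfn_def by (simp add: comp_def)
qed

section \<open>Primitive recursion, arithmetic and bounded quantifiers\<close>

text \<open>\<open>PrimRec\<close> recurses on its first argument with the others as parameters; a
  final composition with \<open>N\<close> and the projections supplies the number of steps.\<close>

lemma recfn_rec_nat:
  assumes N: "recfn k N" and A: "recfn k A"
    and G: "recfn (Suc (Suc k)) (\<lambda>orc e. G orc (e 0) (e (Suc 0)) (\<lambda>i. e (Suc (Suc i))))"
  shows "recfn k (\<lambda>orc e. rec_nat (A orc e) (\<lambda>n r. G orc n r e) (N orc e))"
proof -
  from A obtain a where
    a: "computes orc a xs (A orc (\<lambda>i. xs ! i))" if "length xs = k" for orc xs
    unfolding recfn_def by blast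
  from G obtain g where
    g: "computes orc g xs (G orc (xs ! 0) (xs ! Suc 0) (\<lambda>i. xs ! Suc (Suc i)))"
    if "length xs = Suc (Suc k)" for orc xs
    unfolding recfn_def by blast
  have "computes orc (PrimRec a g) (n # xs)
      (rec_nat (A orc (\<lambda>i. xs ! i)) (\<lambda>n r. G orc n r (\<lambda>i. xs ! i)) n)"
    if "length xs = k" for orc n xs
  proof (induction n)
    case 0
    then show ?case using a[OF that] by (auto intro: computes.primrec_0)
  next
    case (Suc n)
    show ?case
      using computes.primrec_Suc[OF Suc g] that by simp
  qed
  then have "computes orc (PrimRec a g) xs
      (rec_nat (A orc (\<lambda>i. xs ! Suc i)) (\<lambda>n r. G orc n r (\<lambda>i. xs ! Suc i)) (xs ! 0))"
    if "length xs = Suc k" for orc xs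
    using that by (cases xs) auto
  then have R: "recfn (length (N # map (\<lambda>i orc e. e i) [0..<k]))
      (\<lambda>orc e. rec_nat (A orc (\<lambda>i. e (Suc i))) (\<lambda>n r. G orc n r (\<lambda>i. e (Suc i))) (e 0))"
    unfolding recfn_def by auto
  have "recfn k (\<lambda>orc e. rec_nat (A orc (\<lambda>i. map e [0..<k] ! i))
      (\<lambda>n r. G orc n r (\<lambda>i. map e [0..<k] ! i)) (N orc e))"
    using recfn_comp[OF R, of k] N by (force simp: recfn_var comp_def)
  moreover have "map (\<lambda>i. xs ! i) [0..<k] = xs" if "length xs = k" for xs :: "nat list"
    using that map_nth by blast
  ultimately show ?thesis unfolding recfn_def by simp
qed

lemma recfn_add:
  assumes "recfn k A" "recfn k B" shows "recfn k (\<lambda>orc e. A orc e + B orc e)"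
proof -
  have "m + n = rec_nat m (\<lambda>_ r. Suc r) n" for m n :: nat by (induction n) auto
  then show ?thesis by simp (intro recfn_rec_nat recfn_Suc recfn_var assms; simp)
qed

lemma recfn_mult:
  assumes "recfn k A" "recfn k B" shows "recfn k (\<lambda>orc e. A orc e * B orc e)"
proof (rule recfn_comp2[where f = "\<lambda>_. (*)", OF _ assms])
  have "m * n = rec_nat 0 (\<lambda>_ r. r + m) n" for m n :: nat by (induction n) auto
  then show "recfn 2 (\<lambda>orc e. e 0 * e 1)"
    by simp (intro recfn_rec_nat recfn_add recfn_const recfn_var; simp)
qed

lemma recfn_diff:
  assumes "recfn k A" "recfn k B" shows "recfn k (\<lambda>orc e. A orc e - B orc e)"
proof -
  \<comment> \<open>The predecessor is the recursion that returns its counter; truncated subtraction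
    iterates it.\<close>
  have "rec_nat 0 (\<lambda>n _. n) n = n - 1" for n :: nat by (cases n) auto
  then have "m - n = rec_nat m (\<lambda>_ r. rec_nat 0 (\<lambda>n _. n) r) n" for m n :: nat
    by (induction n) auto
  then show ?thesis by (simp only:) (intro recfn_rec_nat recfn_const recfn_var assms; simp)
qed

lemmas recfn_arith = recfn_var recfn_const recfn_Suc recfn_add recfn_mult recfn_diff

lemma recpred_le:
  assumes "recfn k A" "recfn k B" shows "recpred k (\<lambda>orc e. A orc e \<le> B orc e)"
proof -
  have "of_bool (m \<le> n) = 1 - (m - n)" for m n :: nat by auto
  then show ?thesis by (simp only:) (intro recfn_arith assms)
qed

lemma recpred_less:
  assumes "recfn k A" "recfn k B" shows "recpred k (\<lambda>orc e. A orc e < B orc e)"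
  unfolding Suc_le_eq[symmetric] by (intro recpred_le recfn_Suc assms)

lemma recpred_conj:
  assumes "recpred k P" "recpred k Q" shows "recpred k (\<lambda>orc e. P orc e \<and> Q orc e)"
  unfolding of_bool_conj by (intro recfn_arith assms)

lemma recpred_not:
  assumes "recpred k P" shows "recpred k (\<lambda>orc e. \<not> P orc e)"
proof -
  have "of_bool (\<not> b) = 1 - (of_bool b :: nat)" for b by auto
  then show ?thesis by (simp only:) (intro recfn_arith assms)
qed

lemma recpred_disj:
  assumes "recpred k P" "recpred k Q" shows "recpred k (\<lambda>orc e. P orc e \<or> Q orc e)"
  using recpred_not[OF recpred_conj[OF recpred_not recpred_not, OF assms]] by simp

lemma recpred_imp:
  assumes "recpred k P" "recpred k Q" shows "recpred k (\<lambda>orc e. P orc e \<longrightarrow> Q orc e)"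
  unfolding imp_conv_disj by (intro recpred_disj recpred_not assms)

lemma recpred_iff:
  assumes "recpred k P" "recpred k Q" shows "recpred k (\<lambda>orc e. P orc e \<longleftrightarrow> Q orc e)"
  unfolding iff_conv_conj_imp by (intro recpred_conj recpred_imp assms)

lemma recpred_eq:
  assumes "recfn k A" "recfn k B" shows "recpred k (\<lambda>orc e. A orc e = B orc e)"
  unfolding order_eq_iff by (intro recpred_conj recpred_le assms)

text \<open>Both branches always have a value, so the choice can be made by arithmetic on the truth
  value.\<close>

lemma recfn_if:
  assumes "recpred k P" "recfn k A" "recfn k B"
  shows "recfn k (\<lambda>orc e. if P orc e then A orc e else B orc e)"
proof -
  have "(if p then m else n) = of_bool p * m + (1 - of_bool p) * n" for p and m n :: nat by simp
  then show ?thesis by (simp only:) (intro recfn_arith assms)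
qed

lemma recfn_sum:
  assumes "recfn k N" "recfn (Suc k) (\<lambda>orc e. G orc (e 0) (\<lambda>i. e (Suc i)))"
  shows "recfn k (\<lambda>orc e. \<Sum>n<N orc e. G orc n e)"
proof -
  have "sum f {..<n} = rec_nat 0 (\<lambda>n r. r + f n) n" for f :: "nat \<Rightarrow> nat" and n
    by (induction n) auto
  then show ?thesis
    by (simp only:) (intro recfn_rec_nat recfn_add recfn_var recfn_const assms
      recfn_subst[of _ "\<lambda>orc n e. G orc n e"]; simp)
qed

text \<open>The number of witnesses below the bound is a sum of truth values.\<close>

lemma recpred_bex:
  assumes "recfn k N" "recpred (Suc k) (\<lambda>orc e. P orc (e 0) (\<lambda>i. e (Suc i)))"
  shows "recpred k (\<lambda>orc e. \<exists>n<N orc e. P orc n e)"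
proof -
  have "(\<exists>n<m. p n) \<longleftrightarrow> 0 < (\<Sum>n<m. of_bool (p n) :: nat)" for m and p :: "nat \<Rightarrow> bool"
    by (auto simp: sum_eq_0_iff simp flip: neq0_conv)
  then show ?thesis by (simp only:) (intro recpred_less recfn_const recfn_sum assms)
qed

lemma recpred_ball:
  assumes "recfn k N" "recpred (Suc k) (\<lambda>orc e. P orc (e 0) (\<lambda>i. e (Suc i)))"
  shows "recpred k (\<lambda>orc e. \<forall>n<N orc e. P orc n e)"
  using recpred_not[OF recpred_bex[OF assms(1) recpred_not[OF assms(2)]]] by simp

lemma recpred_bex_le:
  assumes "recfn k N" "recpred (Suc k) (\<lambda>orc e. P orc (e 0) (\<lambda>i. e (Suc i)))"
  shows "recpred k (\<lambda>orc e. \<exists>n\<le>N orc e. P orc n e)"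
  unfolding less_Suc_eq_le[symmetric] by (intro recpred_bex recfn_Suc assms)

section \<open>Unbounded search\<close>

text \<open>The characteristic function of \<open>P\<close> has a value everywhere, so
  \<open>Mu\<close> passes over all smaller candidates and stops at the first witness, if there is
  one. The negation is computed because \<open>Mu\<close> looks for the value 0.\<close>

lemma ex_program_Least:
  assumes "recpred (Suc k) (\<lambda>orc e. P orc (e 0) (\<lambda>i. e (Suc i)))"
  shows "\<exists>prog. \<forall>orc xs. length xs = k \<longrightarrow> (\<exists>y. P orc y (\<lambda>i. xs ! i))
    \<longrightarrow> computes orc prog xs (LEAST y. P orc y (\<lambda>i. xs ! i))"
proof -
  from recpred_not[OF assms] obtain f where
    f: "computes orc f xs (of_bool (\<not> P orc (xs ! 0) (\<lambda>i. xs ! Suc i)))"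
    if "length xs = Suc k" for orc xs
    unfolding recfn_def by blast
  have "computes orc (Mu f) xs (LEAST y. P orc y (\<lambda>i. xs ! i))"
    if len: "length xs = k" and ex: "\<exists>y. P orc y (\<lambda>i. xs ! i)" for orc xs
  proof (rule computes.mu)
    have f': "computes orc f (y # xs) (of_bool (\<not> P orc y (\<lambda>i. xs ! i)))" for y
      using f[of "y # xs" orc] len by simp
    show "computes orc f ((LEAST y. P orc y (\<lambda>i. xs ! i)) # xs) 0"
      using f'[of "LEAST y. P orc y (\<lambda>i. xs ! i)"] LeastI_ex[OF ex] by simp
    show "\<forall>y<(LEAST y. P orc y (\<lambda>i. xs ! i)). \<exists>z. computes orc f (y # xs) (Suc z)"
    proof (intro allI impI)
      fix y assume "y < (LEAST y. P orc y (\<lambda>i. xs ! i))"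
      then have "\<not> P orc y (\<lambda>i. xs ! i)" by (rule not_less_Least)
      with f'[of y] show "\<exists>z. computes orc f (y # xs) (Suc z)" by auto
    qed
  qed
  then show ?thesis by blast
qed

text \<open>Remainders, inverses of codings and table lookups are obtained by such a search with a
  guaranteed witness instead of an explicit recursion.\<close>

lemma recfn_Least:
  assumes "recpred (Suc k) (\<lambda>orc e. P orc (e 0) (\<lambda>i. e (Suc i)))" "\<And>orc e. \<exists>y. P orc y e"
  shows "recfn k (\<lambda>orc e. LEAST y. P orc y e)"
  using ex_program_Least[OF assms(1)] assms(2) unfolding recfn_def by blast

lemmas recfn_intros = recfn_arith recpred_le recpred_less recpred_eq recpred_conj recpred_disj
  recpred_not recpred_imp recpred_iff recfn_if recfn_sum recpred_bex recpred_ball recpred_bex_le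
  recfn_query2 recfn_query3

lemma recfn_min:
  assumes "recfn k A" "recfn k B" shows "recfn k (\<lambda>orc e. min (A orc e) (B orc e))"
  unfolding min_def by (intro recfn_intros assms)

lemma recfn_fact:
  assumes "recfn k A" shows "recfn k (\<lambda>orc e. fact (A orc e))"
proof (rule recfn_comp1[where f = "\<lambda>_. fact", OF _ assms])
  have "fact n = rec_nat 1 (\<lambda>n r. Suc n * r) n" for n by (induction n) auto
  then show "recfn 1 (\<lambda>orc e. fact (e 0))"
    by (simp only:) (intro recfn_rec_nat recfn_intros; simp)
qed

lemma recfn_mod:
  assumes "recfn k A" "recfn k B" shows "recfn k (\<lambda>orc e. A orc e mod B orc e)"
proof (rule recfn_comp2[where f = "\<lambda>_. (mod)", OF _ assms])
  have ex: "\<exists>r. \<exists>q\<le>m. m = q * n + r" for m n :: nat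
    by (rule exI[of _ m], rule exI[of _ 0]) simp
  \<comment> \<open>For \<open>n = 0\<close> every \<open>q\<close> forces \<open>r = m\<close>, in
    agreement with \<open>m mod 0 = m\<close>.\<close>
  have "m mod n = (LEAST r. \<exists>q\<le>m. m = q * n + r)" for m n :: nat
  proof (rule Least_equality[symmetric])
    show "\<exists>q\<le>m. m = q * n + m mod n"
      by (rule exI[of _ "m div n"]) simp
  qed auto
  then show "recfn 2 (\<lambda>orc e. e 0 mod e 1)"
    by (simp only:) (intro recfn_Least ex recfn_intros; simp)
qed

section \<open>Codes of pairs and lists\<close>

lemma recfn_prod_encode:
  assumes "recfn k A" "recfn k B" shows "recfn k (\<lambda>orc e. prod_encode (A orc e, B orc e))"
proof (rule recfn_comp2[where f = "\<lambda>_ a b. prod_encode (a, b)", OF _ assms])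
  have "triangle n = (\<Sum>i<Suc n. i)" for n by (induction n) auto
  then show "recfn 2 (\<lambda>orc e. prod_encode (e 0, e 1))"
    by (simp only: prod_encode_def prod.case) (intro recfn_intros; simp)
qed

text \<open>The components of a pair are no larger than its code, so the other component can be
  sought below a bound.\<close>

lemma recfn_fst_prod_decode:
  assumes "recfn k A" shows "recfn k (\<lambda>orc e. fst (prod_decode (A orc e)))"
proof (rule recfn_comp1[where f = "\<lambda>_ a. fst (prod_decode a)", OF _ assms])
  have ex: "\<exists>a. \<exists>b\<le>n. prod_encode (a, b) = n" for n
    by (metis le_prod_encode_2 prod_decode_inverse surj_pair)
  have "fst (prod_decode n) = (LEAST a. \<exists>b\<le>n. prod_encode (a, b) = n)" for n
  proof (rule Least_equality[symmetric])
    show "\<exists>b\<le>n. prod_encode (fst (prod_decode n), b) = n"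
      by (metis le_prod_encode_2 prod_decode_inverse prod.collapse)
  qed auto
  then show "recfn 1 (\<lambda>orc e. fst (prod_decode (e 0)))"
    by (simp only:) (intro recfn_Least ex recfn_intros recfn_prod_encode; simp)
qed

lemma recfn_snd_prod_decode:
  assumes "recfn k A" shows "recfn k (\<lambda>orc e. snd (prod_decode (A orc e)))"
proof (rule recfn_comp1[where f = "\<lambda>_ a. snd (prod_decode a)", OF _ assms])
  have ex: "\<exists>b. \<exists>a\<le>n. prod_encode (a, b) = n" for n
    by (metis le_prod_encode_1 prod_decode_inverse surj_pair)
  have "snd (prod_decode n) = (LEAST b. \<exists>a\<le>n. prod_encode (a, b) = n)" for n
  proof (rule Least_equality[symmetric])
    show "\<exists>a\<le>n. prod_encode (a, snd (prod_decode n)) = n"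
      by (metis le_prod_encode_1 prod_decode_inverse prod.collapse)
  qed auto
  then show "recfn 1 (\<lambda>orc e. snd (prod_decode (e 0)))"
    by (simp only:) (intro recfn_Least ex recfn_intros recfn_prod_encode; simp)
qed

lemma recfn_list_encode_Cons:
  assumes "recfn k A" "recfn k (\<lambda>orc e. list_encode (L orc e))"
  shows "recfn k (\<lambda>orc e. list_encode (A orc e # L orc e))"
  by (simp, intro recfn_Suc recfn_prod_encode assms)

text \<open>Unlike \<^term>\<open>list_decode x ! i\<close>, this has a known value beyond the end of the list.\<close>

definition lnth :: "nat \<Rightarrow> nat \<Rightarrow> nat" where
  "lnth x i = (if i < length (list_decode x) then list_decode x ! i else 0)"

lemma lnth_list_encode: "i < length xs \<Longrightarrow> lnth (list_encode xs) i = xs ! i"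
  by (simp add: lnth_def)

lemma recfn_list_encode_drop_decode:
  assumes "recfn k A" "recfn k B"
  shows "recfn k (\<lambda>orc e. list_encode (drop (A orc e) (list_decode (B orc e))))"
proof (rule recfn_comp2[where f = "\<lambda>_ a b. list_encode (drop a (list_decode b))", OF _ assms])
  \<comment> \<open>The code 0 is the empty list, and every other code is the successor of the code
    of the pair of head and tail; the empty list is its own tail.\<close>
  have tl: "list_encode (tl (list_decode n)) = (if n = 0 then 0 else snd (prod_decode (n - 1)))" for n
    by (cases n) (auto split: prod.splits)
  have "list_encode (drop m (list_decode n))
      = rec_nat n (\<lambda>_ r. list_encode (tl (list_decode r))) m" for m n
  proof (induction m)
    case (Suc m)
    then show ?case by (simp add: drop_Suc tl_drop flip: Suc)
  qed simp
  then show "recfn 2 (\<lambda>orc e. list_encode (drop (e 0) (list_decode (e 1))))"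
    by (simp only: tl) (intro recfn_rec_nat recfn_intros recfn_snd_prod_decode; simp)
qed

lemma list_encode_eq_0_iff: "list_encode xs = 0 \<longleftrightarrow> xs = []"
  by (cases xs) auto

text \<open>The code of the remaining list is 0 exactly from the end on, which tells when the
  default value is due.\<close>

lemma recfn_lnth:
  assumes "recfn k A" "recfn k B" shows "recfn k (\<lambda>orc e. lnth (A orc e) (B orc e))"
proof -
  have "lnth n m = (let r = list_encode (drop m (list_decode n))
      in if r = 0 then 0 else fst (prod_decode (r - 1)))" for m n
    by (cases "drop m (list_decode n)") (auto simp: lnth_def nth_via_drop Let_def)
  then show ?thesis
    unfolding Let_def
    by (simp only:) (intro recfn_intros recfn_fst_prod_decode recfn_list_encode_drop_decode assms)
qed

text \<open>With the next bound, on members, every quantifier over positions or members of a coded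
  list becomes a bounded one.\<close>

lemma length_le_list_encode: "length xs \<le> list_encode xs"
proof (induction xs)
  case (Cons x xs)
  then show ?case using le_prod_encode_2[of "list_encode xs" x] by simp
qed simp

lemma mem_less_list_encode: "x \<in> set xs \<Longrightarrow> x < list_encode xs"
proof (induction xs)
  case (Cons y xs)
  then show ?case
    using le_prod_encode_2[of "list_encode xs" y] le_prod_encode_1[of y "list_encode xs"] by fastforce
qed simp

lemma recpred_mem_list_decode:
  assumes "recfn k A" "recfn k B"
  shows "recpred k (\<lambda>orc e. A orc e \<in> set (list_decode (B orc e)))"
proof (rule recfn_comp2[where f = "\<lambda>_ a b. of_bool (a \<in> set (list_decode b))", OF _ assms])
  have "a \<in> set (list_decode b)
      \<longleftrightarrow> (\<exists>i<b. list_encode (drop i (list_decode b)) \<noteq> 0 \<and> lnth b i = a)" for a b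
    using length_le_list_encode[of "list_decode b"]
    by (auto simp: list_encode_eq_0_iff lnth_def in_set_conv_nth)
  then show "recpred 2 (\<lambda>orc e. e 0 \<in> set (list_decode (e 1)))"
    by (simp only:) (intro recfn_intros recfn_lnth recfn_list_encode_drop_decode; simp)
qed

lemma recpred_bex_list_decode:
  assumes N: "recfn k N" and P: "recpred (Suc k) (\<lambda>orc e. P orc (e 0) (\<lambda>i. e (Suc i)))"
  shows "recpred k (\<lambda>orc e. \<exists>x\<in>set (list_decode (N orc e)). P orc x e)"
proof -
  have "(\<exists>x\<in>set (list_decode n). p x) \<longleftrightarrow> (\<exists>x<n. x \<in> set (list_decode n) \<and> p x)" for n p
    using mem_less_list_encode[of _ "list_decode n"] by auto
  then show ?thesis
    by (simp only:) (intro recfn_intros recpred_mem_list_decode N P recfn_shift[OF N]; simp)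
qed

lemma recpred_ball_list_decode:
  assumes N: "recfn k N" and P: "recpred (Suc k) (\<lambda>orc e. P orc (e 0) (\<lambda>i. e (Suc i)))"
  shows "recpred k (\<lambda>orc e. \<forall>x\<in>set (list_decode (N orc e)). P orc x e)"
  using recpred_not[OF recpred_bex_list_decode[OF N recpred_not[OF P]]] by simp

lemma recfn_list_encode_map_filter:
  assumes N: "recfn k N"
    and F: "recfn (Suc k) (\<lambda>orc e. F orc (e 0) (\<lambda>i. e (Suc i)))"
    and P: "recpred (Suc k) (\<lambda>orc e. P orc (e 0) (\<lambda>i. e (Suc i)))"
  shows "recfn k (\<lambda>orc e. list_encode (map (\<lambda>i. F orc i e) (filter (\<lambda>i. P orc i e) [0..<N orc e])))"
proof -
  \<comment> \<open>The recursion prepends to a coded list, so the list is built from its end: at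
    stage \<open>j\<close> the last \<open>j\<close> indices below \<open>n\<close> have been
    treated.\<close>
  have "list_encode (map f (filter p [n - j..<n])) = rec_nat 0
      (\<lambda>j r. if p (n - Suc j) then Suc (prod_encode (f (n - Suc j), r)) else r) j"
    if "j \<le> n" for f p n j
    using that
  proof (induction j)
    case (Suc j)
    then have "[n - Suc j..<n] = (n - Suc j) # [n - j..<n]"
      by (simp add: upt_conv_Cons Suc_diff_Suc)
    then show ?case using Suc by simp
  qed simp
  from this[OF order_refl]
  have eq: "list_encode (map f (filter p [0..<n])) = rec_nat 0
      (\<lambda>j r. if p (n - Suc j) then Suc (prod_encode (f (n - Suc j), r)) else r) n" for f p n
    by simp
  have M: "recfn (Suc (Suc k)) (\<lambda>orc e. N orc (\<lambda>i. e (Suc (Suc i))) - Suc (e 0))"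
    by (intro recfn_diff recfn_Suc recfn_var recfn_shift[OF recfn_shift[OF N]]) simp
  show ?thesis
    unfolding eq
    by (intro recfn_rec_nat recfn_if recfn_Suc recfn_prod_encode recfn_const N
        recfn_subst[of _ F, OF F M] recfn_subst[of _ "\<lambda>orc n e. of_bool (P orc n e)", OF P M]
        recfn_var; simp)
qed

lemma recfn_list_encode_map:
  assumes "recfn k N" "recfn (Suc k) (\<lambda>orc e. F orc (e 0) (\<lambda>i. e (Suc i)))"
  shows "recfn k (\<lambda>orc e. list_encode (map (\<lambda>i. F orc i e) [0..<N orc e]))"
  using recfn_list_encode_map_filter[where P = "\<lambda>_ _ _. True", OF assms recfn_const] by simp

lemma recfn_list_encode_filter:
  assumes "recfn k N" "recpred (Suc k) (\<lambda>orc e. P orc (e 0) (\<lambda>i. e (Suc i)))"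
  shows "recfn k (\<lambda>orc e. list_encode (filter (\<lambda>i. P orc i e) [0..<N orc e]))"
  using recfn_list_encode_map_filter[where F = "\<lambda>_ i _. i", OF assms(1) recfn_var assms(2)] by simp

section \<open>The algorithm\<close>

type_synonym answers = "query \<Rightarrow> nat list \<Rightarrow> nat"

text \<open>The disjunct \<^term>\<open>y \<ge> c\<close> only makes the search total: every state of the coded automaton is below \<open>c\<close>.\<close>

definition fetch :: "nat \<Rightarrow> nat \<Rightarrow> nat \<Rightarrow> nat" where
  "fetch c q l = (LEAST y. y \<ge> c \<or> list_encode [q, l, y] \<in> set (list_decode (lnth c 2)))"

definition zero_code :: "nat \<Rightarrow> nat" where
  "zero_code d = list_encode (map (\<lambda>i. 0) [0..<d])"

definition idle :: "nat \<Rightarrow> nat \<Rightarrow> nat \<Rightarrow> nat \<Rightarrow> nat" where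
  "idle d c g q = rec_nat q (\<lambda>_ r. fetch c r (zero_code d)) g"

definition letter_at :: "answers \<Rightarrow> nat \<Rightarrow> nat \<Rightarrow> nat" where
  "letter_at orc d n = list_encode (map (\<lambda>i. orc Membership [i, n]) [0..<d])"

definition run_at :: "answers \<Rightarrow> nat \<Rightarrow> nat \<Rightarrow> nat \<Rightarrow> nat" where
  "run_at orc d c n = rec_nat (lnth c 1) (\<lambda>n r. fetch c r (letter_at orc d n)) n"

definition count :: "answers \<Rightarrow> nat \<Rightarrow> nat \<Rightarrow> nat \<Rightarrow> nat" where
  "count orc i a b = (\<Sum>n<b. of_bool (a \<le> n) * orc Membership [i, n])"

definition skipped :: "answers \<Rightarrow> nat \<Rightarrow> nat \<Rightarrow> nat" where
  "skipped orc d X = (\<Sum>n<X. of_bool (letter_at orc d n \<noteq> zero_code d))"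

text \<open>Selects one predicate that contains the position of the letter; on the zero letter the
  guard yields \<open>d\<close>.\<close>

definition track :: "nat \<Rightarrow> nat \<Rightarrow> nat" where
  "track d l = (LEAST i. i \<ge> d \<or> lnth l i = 1)"

text \<open>Again, \<open>Y\<close> only makes the search total.\<close>

definition position :: "answers \<Rightarrow> nat \<Rightarrow> nat \<Rightarrow> nat \<Rightarrow> nat \<Rightarrow> nat" where
  "position orc X Y i k = (LEAST y. y \<ge> Y \<or> X \<le> y \<and> orc Membership [i, y] = 1 \<and> count orc i X y = k)"

text \<open>
  The exponent is congruent to \<open>y - r\<close> modulo \<open>c!\<close> and at least \<open>c\<close>, which is all that matters for
  iterating a map on at most \<open>c\<close> states.
\<close>

definition advance :: "nat \<Rightarrow> nat \<Rightarrow> nat \<Rightarrow> nat \<Rightarrow> nat \<Rightarrow> nat \<Rightarrow> nat" where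
  "advance d c q r y l = fetch c (idle d c (y + fact c * (r + c) - r) q) l"

text \<open>
  A state of the new automaton codes \<open>[t, q, r, v]\<close>: the number \<open>t\<close> of letters read, up to the number
  of letters before \<open>X\<close>; the state \<open>q\<close> of the given automaton after the last letter; a time \<open>r\<close>
  congruent modulo \<open>c!\<close> to the actual one; and for each predicate the number of its elements read
  since \<open>X\<close>, modulo \<open>X!\<close>.
\<close>

definition step :: "answers \<Rightarrow> nat \<Rightarrow> nat \<Rightarrow> nat \<Rightarrow> nat \<Rightarrow> nat \<Rightarrow> nat \<Rightarrow> nat" where
  "step orc d c X Y s l =
     (if lnth s 0 < skipped orc d X
      then list_encode [Suc (lnth s 0), lnth s 1, lnth s 2, lnth s 3]
      else let y = position orc X Y (track d l) (lnth (lnth s 3) (track d l)) in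
        list_encode [lnth s 0, advance d c (lnth s 1) (lnth s 2) y l, Suc y,
          list_encode (map (\<lambda>i. (lnth (lnth s 3) i + lnth l i) mod fact X) [0..<d])])"

text \<open>An entrywise upper bound of the states met on the order word, hence a bound for their
  codes, since coding is monotone. All numbers up to it serve as states, which spares a description
  of the reachable ones.\<close>

definition top_state :: "answers \<Rightarrow> nat \<Rightarrow> nat \<Rightarrow> nat \<Rightarrow> nat \<Rightarrow> nat" where
  "top_state orc d c X Y =
     list_encode [skipped orc d X, c, X + Suc Y, list_encode (map (\<lambda>i. fact X) [0..<d])]"

text \<open>The run of the given automaton on the first \<open>X\<close> letters is computed in
  advance, so the letters of the order word before \<open>X\<close> need only be counted. Here
  \<open>zero_code d\<close> is the zero vector of counters.\<close>

definition start_state :: "answers \<Rightarrow> nat \<Rightarrow> nat \<Rightarrow> nat \<Rightarrow> nat" where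
  "start_state orc d c X = list_encode [0, run_at orc d c X, X, zero_code d]"

text \<open>A test for being the code of a bit vector of length \<open>d\<close>: the number is
  compared with the code rebuilt from its own bits.\<close>

definition is_letter :: "nat \<Rightarrow> nat \<Rightarrow> bool" where
  "is_letter d l \<longleftrightarrow> l = list_encode (map (\<lambda>i. of_bool (lnth l i = 1)) [0..<d])"

text \<open>
  As the gaps are long, the given automaton visits between two letters the whole orbit of \<open>q\<close> under
  the zero letter.
\<close>

definition accepting :: "nat \<Rightarrow> nat \<Rightarrow> nat \<Rightarrow> bool" where
  "accepting d c x \<longleftrightarrow> (\<exists>F\<in>set (list_decode (lnth c 3)). \<forall>a<c.
     a \<in> set (list_decode F) \<longleftrightarrow> (\<exists>s\<in>set (list_decode x). \<exists>g\<le>c. idle d c g (lnth s 1) = a))"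

text \<open>The range ends at the code of the largest state paired with the all-ones letter. The cut
  at \<open>top_state\<close> keeps the transition function inside the state set.\<close>

definition table :: "answers \<Rightarrow> nat \<Rightarrow> nat \<Rightarrow> nat \<Rightarrow> nat \<Rightarrow> nat" where
  "table orc d c X Y = list_encode
     (map (\<lambda>k. list_encode [fst (prod_decode k), snd (prod_decode k),
         min (step orc d c X Y (fst (prod_decode k)) (snd (prod_decode k))) (top_state orc d c X Y)])
       (filter (\<lambda>k. fst (prod_decode k) \<le> top_state orc d c X Y \<and> is_letter d (snd (prod_decode k)))
         [0..<Suc (prod_encode (top_state orc d c X Y, list_encode (map (\<lambda>i. 1) [0..<d])))]))"

text \<open>Every set of states has an increasing list, whose code is at most that of the list of
  all states. A set may occur through several of its lists, which \<open>presents\<close>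
  allows.\<close>

definition final_sets :: "answers \<Rightarrow> nat \<Rightarrow> nat \<Rightarrow> nat \<Rightarrow> nat \<Rightarrow> nat" where
  "final_sets orc d c X Y = list_encode
     (filter (\<lambda>x. (\<forall>s\<in>set (list_decode x). s \<le> top_state orc d c X Y) \<and> accepting d c x)
       [0..<Suc (list_encode (map (\<lambda>s. s) [0..<Suc (top_state orc d c X Y)]))])"

text \<open>The two bounds come coded as one number \<open>w\<close>, the outcome of a single
  search.\<close>

definition result_code :: "answers \<Rightarrow> nat \<Rightarrow> nat \<Rightarrow> nat \<Rightarrow> nat" where
  "result_code orc d c w = (let X = fst (prod_decode w); Y = snd (prod_decode w) in
     list_encode
       [list_encode (map (\<lambda>s. s) [0..<Suc (top_state orc d c X Y)]),
        min (start_state orc d c X) (top_state orc d c X Y),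
        table orc d c X Y,
        final_sets orc d c X Y])"

text \<open>The period \<open>p\<close> of each predicate is at most \<open>X\<close>, so that \<open>X!\<close> is a common period.\<close>

definition admissible :: "answers \<Rightarrow> nat \<Rightarrow> nat \<Rightarrow> nat \<Rightarrow> nat \<Rightarrow> bool" where
  "admissible orc d c X Y \<longleftrightarrow> (\<forall>i<d.
     (\<forall>j<d. \<forall>z\<in>set (list_decode (orc Sparsity [i, j, c + 2])). fst (prod_decode z) < count orc i 0 X)
   \<and> (\<forall>n<X + c. X \<le> n \<longrightarrow> orc Membership [i, n] = 0)
   \<and> fst (prod_decode (orc Procyclicity [i, fact c])) \<le> count orc i 0 X
   \<and> snd (prod_decode (orc Procyclicity [i, fact c])) \<le> X
   \<and> fact X \<le> count orc i X Y)"

section \<open>Computability of the ingredients of the algorithm\<close>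

lemmas recfn_code_intros = recfn_intros recfn_min recfn_fact recfn_mod recfn_prod_encode
  recfn_fst_prod_decode recfn_snd_prod_decode recfn_list_encode_Cons recfn_lnth
  recpred_mem_list_decode recpred_bex_list_decode recpred_ball_list_decode
  recfn_list_encode_map_filter recfn_list_encode_map recfn_list_encode_filter

lemma recfn_fetch:
  "recfn k A \<Longrightarrow> recfn k B \<Longrightarrow> recfn k C \<Longrightarrow> recfn k (\<lambda>orc e. fetch (A orc e) (B orc e) (C orc e))"
proof (rule recfn_comp3[where f = "\<lambda>_. fetch"])
  show "recfn 3 (\<lambda>orc e. fetch (e 0) (e 1) (e 2))"
    unfolding fetch_def by (rule recfn_Least; (intro recfn_code_intros; simp)?) auto
qed

lemma recfn_zero_code: "recfn k A \<Longrightarrow> recfn k (\<lambda>orc e. zero_code (A orc e))"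
  unfolding zero_code_def by (intro recfn_code_intros)

lemma recfn_idle:
  "recfn k A \<Longrightarrow> recfn k B \<Longrightarrow> recfn k C \<Longrightarrow> recfn k D
    \<Longrightarrow> recfn k (\<lambda>orc e. idle (A orc e) (B orc e) (C orc e) (D orc e))"
proof (rule recfn_comp4[where f = "\<lambda>_. idle"])
  show "recfn 4 (\<lambda>orc e. idle (e 0) (e 1) (e 2) (e 3))"
    unfolding idle_def
    by (intro recfn_rec_nat recfn_fetch recfn_zero_code recfn_code_intros; simp)
qed

lemma recfn_letter_at:
  "recfn k A \<Longrightarrow> recfn k B \<Longrightarrow> recfn k (\<lambda>orc e. letter_at orc (A orc e) (B orc e))"
proof (rule recfn_comp2[where f = letter_at])
  show "recfn 2 (\<lambda>orc e. letter_at orc (e 0) (e 1))"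
    unfolding letter_at_def by (intro recfn_code_intros; simp)
qed

lemma recfn_run_at:
  "recfn k A \<Longrightarrow> recfn k B \<Longrightarrow> recfn k C \<Longrightarrow> recfn k (\<lambda>orc e. run_at orc (A orc e) (B orc e) (C orc e))"
proof (rule recfn_comp3[where f = run_at])
  show "recfn 3 (\<lambda>orc e. run_at orc (e 0) (e 1) (e 2))"
    unfolding run_at_def
    by (intro recfn_rec_nat recfn_fetch recfn_letter_at recfn_code_intros; simp)
qed

lemma recfn_count:
  "recfn k A \<Longrightarrow> recfn k B \<Longrightarrow> recfn k C \<Longrightarrow> recfn k (\<lambda>orc e. count orc (A orc e) (B orc e) (C orc e))"
proof (rule recfn_comp3[where f = count])
  show "recfn 3 (\<lambda>orc e. count orc (e 0) (e 1) (e 2))"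
    unfolding count_def by (intro recfn_code_intros; simp)
qed

lemma recfn_skipped:
  "recfn k A \<Longrightarrow> recfn k B \<Longrightarrow> recfn k (\<lambda>orc e. skipped orc (A orc e) (B orc e))"
proof (rule recfn_comp2[where f = skipped])
  show "recfn 2 (\<lambda>orc e. skipped orc (e 0) (e 1))"
    unfolding skipped_def by (intro recfn_letter_at recfn_zero_code recfn_code_intros; simp)
qed

lemma recfn_track:
  "recfn k A \<Longrightarrow> recfn k B \<Longrightarrow> recfn k (\<lambda>orc e. track (A orc e) (B orc e))"
proof (rule recfn_comp2[where f = "\<lambda>_. track"])
  show "recfn 2 (\<lambda>orc e. track (e 0) (e 1))"
    unfolding track_def by (rule recfn_Least; (intro recfn_code_intros; simp)?) auto
qed

lemma recfn_position:
  "recfn k A \<Longrightarrow> recfn k B \<Longrightarrow> recfn k C \<Longrightarrow> recfn k D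
    \<Longrightarrow> recfn k (\<lambda>orc e. position orc (A orc e) (B orc e) (C orc e) (D orc e))"
proof (rule recfn_comp4[where f = position])
  show "recfn 4 (\<lambda>orc e. position orc (e 0) (e 1) (e 2) (e 3))"
    unfolding position_def
    by (rule recfn_Least; (intro recfn_count recfn_code_intros; simp)?) auto
qed

lemma recfn_advance:
  "recfn k A \<Longrightarrow> recfn k B \<Longrightarrow> recfn k C \<Longrightarrow> recfn k D \<Longrightarrow> recfn k E \<Longrightarrow> recfn k F
    \<Longrightarrow> recfn k (\<lambda>orc e. advance (A orc e) (B orc e) (C orc e) (D orc e) (E orc e) (F orc e))"
  unfolding advance_def by (intro recfn_fetch recfn_idle recfn_code_intros)

lemma recfn_step:
  "recfn k A \<Longrightarrow> recfn k B \<Longrightarrow> recfn k C \<Longrightarrow> recfn k D \<Longrightarrow> recfn k E \<Longrightarrow> recfn k F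
    \<Longrightarrow> recfn k (\<lambda>orc e. step orc (A orc e) (B orc e) (C orc e) (D orc e) (E orc e) (F orc e))"
proof (rule recfn_comp6[where f = step])
  show "recfn 6 (\<lambda>orc e. step orc (e 0) (e 1) (e 2) (e 3) (e 4) (e 5))"
    unfolding step_def Let_def
    by (intro recfn_skipped recfn_track recfn_position recfn_advance recfn_code_intros; simp)
qed

lemma recfn_top_state:
  "recfn k A \<Longrightarrow> recfn k B \<Longrightarrow> recfn k C \<Longrightarrow> recfn k D
    \<Longrightarrow> recfn k (\<lambda>orc e. top_state orc (A orc e) (B orc e) (C orc e) (D orc e))"
proof (rule recfn_comp4[where f = top_state])
  show "recfn 4 (\<lambda>orc e. top_state orc (e 0) (e 1) (e 2) (e 3))"
    unfolding top_state_def by (intro recfn_skipped recfn_code_intros; simp)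
qed

lemma recfn_start_state:
  "recfn k A \<Longrightarrow> recfn k B \<Longrightarrow> recfn k C
    \<Longrightarrow> recfn k (\<lambda>orc e. start_state orc (A orc e) (B orc e) (C orc e))"
  unfolding start_state_def by (intro recfn_run_at recfn_zero_code recfn_code_intros)

lemma recpred_is_letter:
  "recfn k A \<Longrightarrow> recfn k B \<Longrightarrow> recpred k (\<lambda>orc e. is_letter (A orc e) (B orc e))"
proof (rule recfn_comp2[where f = "\<lambda>_ a b. of_bool (is_letter a b)"])
  show "recpred 2 (\<lambda>orc e. is_letter (e 0) (e 1))"
    unfolding is_letter_def by (intro recfn_code_intros; simp)
qed

lemma recpred_accepting:
  "recfn k A \<Longrightarrow> recfn k B \<Longrightarrow> recfn k C \<Longrightarrow> recpred k (\<lambda>orc e. accepting (A orc e) (B orc e) (C orc e))"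
proof (rule recfn_comp3[where f = "\<lambda>_ a b c. of_bool (accepting a b c)"])
  show "recpred 3 (\<lambda>orc e. accepting (e 0) (e 1) (e 2))"
    unfolding accepting_def by (intro recfn_idle recfn_code_intros; simp)
qed

lemma recfn_table:
  "recfn k A \<Longrightarrow> recfn k B \<Longrightarrow> recfn k C \<Longrightarrow> recfn k D
    \<Longrightarrow> recfn k (\<lambda>orc e. table orc (A orc e) (B orc e) (C orc e) (D orc e))"
proof (rule recfn_comp4[where f = table])
  show "recfn 4 (\<lambda>orc e. table orc (e 0) (e 1) (e 2) (e 3))"
    unfolding table_def
    by (intro recfn_step recfn_top_state recpred_is_letter recfn_code_intros; simp)
qed

lemma recfn_final_sets:
  "recfn k A \<Longrightarrow> recfn k B \<Longrightarrow> recfn k C \<Longrightarrow> recfn k D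
    \<Longrightarrow> recfn k (\<lambda>orc e. final_sets orc (A orc e) (B orc e) (C orc e) (D orc e))"
proof (rule recfn_comp4[where f = final_sets])
  show "recfn 4 (\<lambda>orc e. final_sets orc (e 0) (e 1) (e 2) (e 3))"
    unfolding final_sets_def
    by (intro recfn_top_state recpred_accepting recfn_code_intros; simp)
qed

lemma recfn_result_code: "recfn 3 (\<lambda>orc e. result_code orc (e 0) (e 1) (e 2))"
  unfolding result_code_def Let_def
  by (intro recfn_table recfn_final_sets recfn_top_state recfn_start_state recfn_code_intros; simp)

lemma recpred_admissible:
  "recpred 3 (\<lambda>orc e. admissible orc (e 1) (e 2) (fst (prod_decode (e 0))) (snd (prod_decode (e 0))))"
  unfolding admissible_def by (intro recfn_count recfn_code_intros; simp)

text \<open>A search for the least coded pair of bounds, followed by a total function. One program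
  serves all oracles and all \<open>d\<close> and \<open>c\<close>.\<close>

lemma ex_program_result_code:
  "\<exists>prog. \<forall>orc d c. (\<exists>X Y. admissible orc d c X Y) \<longrightarrow>
     (\<exists>X Y. admissible orc d c X Y \<and> computes orc prog [d, c] (result_code orc d c (prod_encode (X, Y))))"
proof -
  let ?adm = "\<lambda>orc w d c. admissible orc d c (fst (prod_decode w)) (snd (prod_decode w))"
  have "recpred (Suc 2) (\<lambda>orc e. ?adm orc (e 0) (e (Suc 0)) (e (Suc 1)))"
    using recpred_admissible by (simp add: eval_nat_numeral)
  from ex_program_Least[where P = "\<lambda>orc w e. ?adm orc w (e 0) (e 1)", OF this]
  obtain search where search: "\<And>orc xs. length xs = 2 \<Longrightarrow> \<exists>w. ?adm orc w (xs ! 0) (xs ! 1)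
      \<Longrightarrow> computes orc search xs (LEAST w. ?adm orc w (xs ! 0) (xs ! 1))"
    by blast
  from recfn_result_code obtain out where
    out: "computes orc out xs (result_code orc (xs ! 0) (xs ! 1) (xs ! 2))" if "length xs = 3" for orc xs
    unfolding recfn_def by blast
  show ?thesis
  proof (intro exI[of _ "Comp out [Proj 0, Proj 1, search]"] allI impI)
    fix orc d c assume "\<exists>X Y. admissible orc d c X Y"
    then have ex: "\<exists>w. ?adm orc w d c" by (metis fst_conv prod_encode_inverse snd_conv)
    define w where "w = (LEAST w. ?adm orc w d c)"
    have "computes orc search [d, c] w" using search[of "[d, c]" orc] ex by (simp add: w_def)
    moreover have "computes orc (Proj 0) [d, c] d" "computes orc (Proj 1) [d, c] c"
      using computes.proj[of 0 "[d, c]" orc] computes.proj[of 1 "[d, c]" orc] by simp_all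
    ultimately have "list_all2 (\<lambda>g y. computes orc g [d, c] y) [Proj 0, Proj 1, search] [d, c, w]"
      by simp
    from computes.comp[OF this out]
    have "computes orc (Comp out [Proj 0, Proj 1, search]) [d, c] (result_code orc d c w)" by simp
    moreover have "?adm orc w d c" unfolding w_def using ex by (rule LeastI_ex)
    ultimately show "\<exists>X Y. admissible orc d c X Y
        \<and> computes orc (Comp out [Proj 0, Proj 1, search]) [d, c] (result_code orc d c (prod_encode (X, Y)))"
      by (intro exI[of _ "fst (prod_decode w)"] exI[of _ "snd (prod_decode w)"]) simp
  qed
qed

section \<open>Iteration, enumeration and codes\<close>

text \<open>Pigeonhole: two of the \<open>c + 1\<close> iterates with exponents up to
  \<open>c\<close> agree, and they still agree after equally many further steps.\<close>

lemma funpow_eventually_periodic: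
  assumes f: "\<And>x. x \<in> S \<Longrightarrow> f x \<in> S" and S: "finite S" "card S \<le> c" and q: "q \<in> S"
  obtains i j where "i < j" "j \<le> c" "\<And>n. i \<le> n \<Longrightarrow> (f ^^ (n + (j - i))) q = (f ^^ n) q"
proof -
  have fS: "(f ^^ n) q \<in> S" for n by (induction n) (auto simp: f q)
  have "\<not> inj_on (\<lambda>n. (f ^^ n) q) {..c}"
  proof
    assume "inj_on (\<lambda>n. (f ^^ n) q) {..c}"
    then have "card {..c} \<le> card S" by (rule card_inj_on_le) (auto simp: fS S)
    with S show False by simp
  qed
  then obtain i j where ij: "i < j" "j \<le> c" "(f ^^ i) q = (f ^^ j) q"
    unfolding inj_on_def by (metis atMost_iff linorder_neqE_nat)
  show ?thesis
  proof (rule that[OF ij(1,2)])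
    fix n assume "i \<le> n"
    then have "n = (n - i) + i" "n + (j - i) = (n - i) + j" using ij by auto
    then show "(f ^^ (n + (j - i))) q = (f ^^ n) q"
      using ij(3) funpow_add[of "n - i" i f] funpow_add[of "n - i" j f] by simp
  qed
qed

text \<open>The preperiod is less than \<open>c\<close>, and the period is at most \<open>c\<close>
  and so divides \<open>c!\<close>.\<close>

lemma funpow_cong_fact:
  assumes f: "\<And>x. x \<in> S \<Longrightarrow> f x \<in> S" and S: "finite S" "card S \<le> c" and q: "q \<in> S"
    and gh: "c \<le> g" "c \<le> h" "[g = h] (mod fact c)"
  shows "(f ^^ g) q = (f ^^ h) q"
proof -
  obtain i j where ij: "i < j" "j \<le> c" and per: "\<And>n. i \<le> n \<Longrightarrow> (f ^^ (n + (j - i))) q = (f ^^ n) q"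
    using funpow_eventually_periodic[of S f c q] f S q by metis
  have mult: "(f ^^ (n + k * (j - i))) q = (f ^^ n) q" if "i \<le> n" for n k
  proof (induction k)
    case (Suc k)
    then show ?case using per[of "n + k * (j - i)"] that by (simp add: ac_simps)
  qed simp
  have "(j - i) dvd fact c" using ij by (intro dvd_fact) auto
  then obtain m where m: "fact c = (j - i) * m" by blast
  have *: "(f ^^ h) q = (f ^^ g) q" if *: "c \<le> g" "g \<le> h" "[g = h] (mod fact c)" for g h
  proof -
    obtain k where "h = k * fact c + g"
      using *(3) cong_le_nat[OF *(2), of "fact c"] by (auto simp: cong_sym_eq)
    then show ?thesis using mult[of g "k * m"] * ij m by (simp add: ac_simps)
  qed
  show ?thesis
  proof (cases "g \<le> h")
    case True
    then show ?thesis using *[of g h] gh by simp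
  next
    case False
    then show ?thesis using *[of h g] gh by (simp add: cong_sym_eq)
  qed
qed

text \<open>An exponent above \<open>c\<close> is still beyond the preperiod after one period has
  been removed.\<close>

lemma funpow_bounded_exponent:
  assumes f: "\<And>x. x \<in> S \<Longrightarrow> f x \<in> S" and S: "finite S" "card S \<le> c" and q: "q \<in> S"
  shows "\<exists>h\<le>c. (f ^^ g) q = (f ^^ h) q"
proof -
  obtain i j where ij: "i < j" "j \<le> c" and per: "\<And>n. i \<le> n \<Longrightarrow> (f ^^ (n + (j - i))) q = (f ^^ n) q"
    using funpow_eventually_periodic[of S f c q] f S q by metis
  show ?thesis
  proof (induction g rule: less_induct)
    case (less g)
    show ?case
    proof (cases "g \<le> c")
      case False
      then have "(f ^^ g) q = (f ^^ (g - (j - i))) q" using per[of "g - (j - i)"] ij by simp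
      with less[of "g - (j - i)"] False ij show ?thesis by auto
    qed auto
  qed
qed

section \<open>Counting and enumeration\<close>

text \<open>Counting smaller elements inverts the enumeration; this turns the indices in the oracle
  data into counts, which the algorithm can compute.\<close>

lemma card_less_enumerate:
  fixes S :: "nat set"
  assumes "infinite S"
  shows "card {n \<in> S. n < enumerate S j} = j"
proof -
  have "{n \<in> S. n < enumerate S j} = enumerate S ` {..<j}"
  proof (intro equalityI subsetI)
    fix n assume n: "n \<in> {n \<in> S. n < enumerate S j}"
    then obtain k where "n = enumerate S k" using enumerate_Ex[OF assms, of n] by auto
    with n show "n \<in> enumerate S ` {..<j}" using assms by (auto simp: enumerate_mono_iff)
  qed (use assms in \<open>auto simp: enumerate_in_set\<close>)
  moreover have "inj_on (enumerate S) {..<j}"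
    using assms by (metis inj_enumerate inj_on_subset top_greatest)
  ultimately show ?thesis by (simp add: card_image)
qed

lemma enumerate_card_less:
  fixes S :: "nat set"
  assumes "infinite S" "x \<in> S"
  shows "enumerate S (card {n \<in> S. n < x}) = x"
  using enumerate_Ex[OF assms] card_less_enumerate[OF assms(1)] by auto

text \<open>A Galois connection: the index of the first element at or beyond \<open>x\<close> is the
  number of elements before \<open>x\<close>.\<close>

lemma le_enumerate_iff:
  fixes S :: "nat set"
  assumes "infinite S"
  shows "x \<le> enumerate S j \<longleftrightarrow> card {n \<in> S. n < x} \<le> j"
proof
  assume "x \<le> enumerate S j"
  then have "card {n \<in> S. n < x} \<le> card {n \<in> S. n < enumerate S j}"
    by (intro card_mono) auto
  then show "card {n \<in> S. n < x} \<le> j" by (simp add: card_less_enumerate[OF assms])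
next
  assume le: "card {n \<in> S. n < x} \<le> j"
  show "x \<le> enumerate S j"
  proof (rule ccontr)
    assume "\<not> x \<le> enumerate S j"
    then have "card {n \<in> S. n < enumerate S (Suc j)} \<le> card {n \<in> S. n < x}"
      using enumerate_Suc''[OF assms, of j] enumerate_in_set[OF assms]
      by (intro card_mono) (auto dest!: not_less_Least simp: not_le)
    with le show False by (simp add: card_less_enumerate[OF assms])
  qed
qed

section \<open>Monotonicity of codes, and codes of letters\<close>

lemma prod_encode_mono:
  assumes "a \<le> a'" "b \<le> b'" shows "prod_encode (a, b) \<le> prod_encode (a', b')"
proof -
  have "triangle m \<le> triangle n" if "m \<le> n" for m n
    using that by (induction n rule: dec_induct) auto
  from this[of "a + b" "a' + b'"] assms show ?thesis by (simp add: prod_encode_def)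
qed

lemma list_encode_mono: "list_all2 (\<le>) xs ys \<Longrightarrow> list_encode xs \<le> list_encode ys"
  by (induction rule: list_all2_induct) (auto intro: prod_encode_mono)

lemma list_encode_filter_le: "list_encode (filter p xs) \<le> list_encode xs"
proof (induction xs)
  case (Cons x xs)
  then show ?case
    using le_prod_encode_2[of "list_encode xs" x] prod_encode_mono[OF order_refl Cons] by auto
qed simp

lemma letter_code_inject: "letter_code b = letter_code b' \<longleftrightarrow> b = b'"
  unfolding letter_code_def list_encode_eq by (rule inj_map_eq_map) (auto simp: inj_def)

lemma lnth_letter_code: "i < length b \<Longrightarrow> lnth (letter_code b) i = of_bool (b ! i)"
  by (simp add: letter_code_def lnth_list_encode)

lemma zero_code_eq: "zero_code d = letter_code (replicate d False)"
  by (simp add: zero_code_def letter_code_def map_replicate_const)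

lemma is_letter_letter_code:
  assumes "b \<in> bitvecs d" shows "is_letter d (letter_code b)"
proof -
  have "map (\<lambda>i. of_bool (lnth (letter_code b) i = 1)) [0..<d] = (map of_bool b :: nat list)"
    using assms by (intro nth_equalityI) (auto simp: bitvecs_def lnth_letter_code)
  then show ?thesis unfolding is_letter_def by (simp only: letter_code_def)
qed

lemma is_letter_imp: "is_letter d l \<Longrightarrow> letter_code (map (\<lambda>i. lnth l i = 1) [0..<d]) = l"
  by (simp add: is_letter_def letter_code_def comp_def)

lemma letter_code_le:
  assumes "b \<in> bitvecs d" shows "letter_code b \<le> list_encode (map (\<lambda>i. 1) [0..<d])"
  unfolding letter_code_def
  by (rule list_encode_mono) (use assms in \<open>auto simp: bitvecs_def list_all2_conv_all_nth\<close>)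

section \<open>Correctness\<close>

locale setting =
  fixes d :: nat and A :: "(nat, bool list) dma" and c :: nat and P :: "nat \<Rightarrow> nat set"
    and pc :: "nat \<Rightarrow> nat \<Rightarrow> nat \<times> nat" and sp :: "nat \<Rightarrow> nat \<Rightarrow> nat \<Rightarrow> (nat \<times> nat) list"
  assumes d_pos: "d \<ge> 1"
    and A_over: "dma_over (bitvecs d) A"
    and A_code: "presents d c A"
    and infinite_P: "\<And>i. i < d \<Longrightarrow> infinite (P i)"
    and pc_data: "procyclicity_data d P pc"
    and sp_data: "sparsity_data d P sp"
begin

abbreviation "orc \<equiv> answer P pc sp"

abbreviation "\<alpha> \<equiv> char_word d P"

abbreviation "\<beta> \<equiv> order_word d P"

definition support :: "nat set" where
  "support = {n. \<alpha> n \<noteq> replicate d False}"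

lemma char_word_bitvecs: "\<alpha> n \<in> bitvecs d"
  by (simp add: char_word_def bitvecs_def)

lemma mem_support_iff: "n \<in> support \<longleftrightarrow> (\<exists>i<d. n \<in> P i)"
proof -
  have "\<alpha> n = replicate d False \<longleftrightarrow> (\<forall>i<d. n \<notin> P i)"
    by (auto simp: char_word_def list_eq_iff_nth_eq)
  then show ?thesis by (auto simp: support_def)
qed

lemma infinite_support: "infinite support"
  using infinite_P[of 0] d_pos by (meson infinite_super less_le_trans mem_support_iff subsetI zero_less_one)

lemma order_word_eq: "\<beta> j = \<alpha> (enumerate support j)"
  by (simp add: order_word_def support_def)

lemma letter_at_eq: "letter_at orc d n = letter_code (\<alpha> n)"
  by (simp add: letter_at_def letter_code_def char_word_def comp_def)

lemma count_eq: "count orc i a b = card {n \<in> P i. a \<le> n \<and> n < b}"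
proof -
  have "count orc i a b = (\<Sum>n<b. of_bool (n \<in> P i \<and> a \<le> n))"
    unfolding count_def by (rule sum.cong) auto
  also have "\<dots> = card ({..<b} \<inter> {n. n \<in> P i \<and> a \<le> n})" by simp
  also have "{..<b} \<inter> {n. n \<in> P i \<and> a \<le> n} = {n \<in> P i. a \<le> n \<and> n < b}" by auto
  finally show ?thesis .
qed

lemma skipped_eq: "skipped orc d X = card {n \<in> support. n < X}"
proof -
  have "skipped orc d X = (\<Sum>n<X. of_bool (n \<in> support))"
    by (simp add: skipped_def letter_at_eq zero_code_eq letter_code_inject support_def)
  also have "\<dots> = card ({..<X} \<inter> support)" by simp
  also have "{..<X} \<inter> support = {n \<in> support. n < X}" by auto
  finally show ?thesis .
qed

text \<open>The strict bound by \<open>c\<close> has two uses: the guard in \<open>fetch\<close>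
  never cuts off a real transition, and there are at most \<open>c\<close> states.\<close>

lemma states_less: "q \<in> states A \<Longrightarrow> q < c"
  and init_code: "lnth c 1 = init A"
  and fetch_eq: "q \<in> states A \<Longrightarrow> b \<in> bitvecs d \<Longrightarrow> fetch c q (letter_code b) = delta A q b"
  and acc_code: "(\<lambda>F. set (list_decode F)) ` set (list_decode (lnth c 3)) = acc A"
proof -
  obtain Qs ts Fs where Qs: "set Qs = states A"
    and ts: "set ts = {(q, b, delta A q b) | q b. q \<in> states A \<and> b \<in> bitvecs d}"
    and Fs: "set ` set Fs = acc A"
    and c: "c = list_encode [list_encode Qs, init A,
      list_encode (map (\<lambda>(q, b, q'). list_encode [q, letter_code b, q']) ts),
      list_encode (map list_encode Fs)]"
    using A_code unfolding presents_def by blast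
  show less: "q < c" if "q \<in> states A" for q
  proof -
    have "q < list_encode Qs" using that Qs by (intro mem_less_list_encode) simp
    also have "\<dots> < c" unfolding c by (rule mem_less_list_encode) simp
    finally show ?thesis .
  qed
  have c1: "lnth c 1 = init A"
    and c2: "list_decode (lnth c 2) = map (\<lambda>(q, b, q'). list_encode [q, letter_code b, q']) ts"
    and c3: "list_decode (lnth c 3) = map list_encode Fs"
    unfolding c by (simp_all add: lnth_list_encode del: list_encode.simps)
  show "lnth c 1 = init A" by (rule c1)
  show "(\<lambda>F. set (list_decode F)) ` set (list_decode (lnth c 3)) = acc A"
    unfolding c3 Fs[symmetric] by (simp add: image_image)
  show "fetch c q (letter_code b) = delta A q b" if q: "q \<in> states A" and b: "b \<in> bitvecs d"
    unfolding fetch_def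
  proof (rule Least_equality)
    \<comment> \<open>The table is functional: the successor state is the only entry for
      \<open>q\<close> and \<open>b\<close>.\<close>
    have iff: "list_encode [q, letter_code b, y] \<in> set (list_decode (lnth c 2)) \<longleftrightarrow> y = delta A q b" for y
      unfolding c2 set_map ts using q b
      by (force simp: list_encode_eq letter_code_inject simp del: list_encode.simps)
    then show "c \<le> delta A q b \<or> list_encode [q, letter_code b, delta A q b] \<in> set (list_decode (lnth c 2))"
      by simp
    fix y assume "c \<le> y \<or> list_encode [q, letter_code b, y] \<in> set (list_decode (lnth c 2))"
    moreover have "delta A q b < c" using less A_over q b by (simp add: dma_over_def)
    ultimately show "delta A q b \<le> y" using iff by auto
  qed
qed

definition zstep :: "nat \<Rightarrow> nat" where
  "zstep q = delta A q (replicate d False)"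

lemma delta_states: "q \<in> states A \<Longrightarrow> b \<in> bitvecs d \<Longrightarrow> delta A q b \<in> states A"
  using A_over by (simp add: dma_over_def)

lemma zstep_states: "q \<in> states A \<Longrightarrow> zstep q \<in> states A"
  unfolding zstep_def by (rule delta_states) (simp_all add: bitvecs_def)

lemma funpow_zstep_states: "q \<in> states A \<Longrightarrow> (zstep ^^ g) q \<in> states A"
  by (induction g) (auto simp: zstep_states)

lemma finite_states: "finite (states A)"
  using A_over by (simp add: dma_over_def)

lemma card_states: "card (states A) \<le> c"
  using card_mono[of "{..<c}" "states A"] states_less by auto

lemma idle_eq: "q \<in> states A \<Longrightarrow> idle d c g q = (zstep ^^ g) q"
proof (induction g)
  case (Suc g)
  then show ?case
    using fetch_eq[OF funpow_zstep_states[OF Suc.prems, of g], of "replicate d False"]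
    by (simp add: idle_def zero_code_eq bitvecs_def zstep_def[of "(zstep ^^ g) q"])
qed (simp add: idle_def)

lemma run_states: "dma_run A \<alpha> n \<in> states A"
  using A_over by (induction n) (auto simp: dma_over_def char_word_bitvecs)

lemma run_at_eq: "run_at orc d c n = dma_run A \<alpha> n"
proof (induction n)
  case (Suc n)
  then show ?case
    by (simp add: run_at_def letter_at_eq fetch_eq[OF run_states char_word_bitvecs])
qed (simp add: run_at_def init_code[simplified])

lemma count_0_eq: "count orc i 0 x = card {n \<in> P i. n < x}"
  by (simp add: count_eq)

lemma count_split: "a \<le> b \<Longrightarrow> b \<le> x \<Longrightarrow> count orc i a x = count orc i a b + count orc i b x"
proof -
  assume ab: "a \<le> b" "b \<le> x"
  have "{n \<in> P i. a \<le> n \<and> n < x} = {n \<in> P i. a \<le> n \<and> n < b} \<union> {n \<in> P i. b \<le> n \<and> n < x}"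
    using ab by auto
  then show ?thesis unfolding count_eq by (simp add: card_Un_disjoint disjoint_iff)
qed

lemma count_Suc: "a \<le> x \<Longrightarrow> count orc i a (Suc x) = count orc i a x + of_bool (x \<in> P i)"
  by (simp add: count_def)

lemma count_mono: "x \<le> y \<Longrightarrow> count orc i a x \<le> count orc i a y"
  unfolding count_eq by (rule card_mono) auto

section \<open>Existence of the bounds\<close>

text \<open>The element \<open>x\<close> has index \<open>count orc i 0 x\<close> in
  \<open>P i\<close>, so an element of \<open>P j\<close> shortly after it makes this index appear
  in the sparsity answer.\<close>

lemma sparse_gap:
  assumes "i < d" "j < d" "x \<in> P i" "y \<in> P j" "x < y" "y < x + K"
  shows "\<exists>z\<in>set (list_decode (orc Sparsity [i, j, K])). fst (prod_decode z) = count orc i 0 x"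
proof -
  have "(count orc i 0 x, count orc j 0 y) \<in> set (sp i j K)"
    using sp_data assms infinite_P
    by (simp add: sparsity_data_def count_0_eq enumerate_card_less)
  then show ?thesis by force
qed

text \<open>As the predicates are infinite, all counts are unbounded, which settles every condition
  but the one on zeros from \<open>X\<close> on; for that one, \<open>X\<close> is put right behind
  an element of \<open>P 0\<close>.\<close>

lemma ex_admissible: "\<exists>X Y. admissible orc d c X Y"
proof -
  have ev: "\<forall>\<^sub>F x in sequentially. n \<le> count orc i a x" if "i < d" for i a n
  proof (rule eventually_sequentiallyI)
    let ?x = "enumerate (P i) (count orc i 0 a + n)"
    fix x assume "?x \<le> x"
    have inf: "infinite (P i)" using infinite_P that .
    have "a \<le> ?x" unfolding le_enumerate_iff[OF inf] by (simp add: count_0_eq)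
    then have "count orc i 0 ?x = count orc i 0 a + count orc i a ?x" by (intro count_split) auto
    moreover have "count orc i 0 ?x = count orc i 0 a + n"
      by (simp add: count_0_eq card_less_enumerate[OF inf])
    ultimately have "n = count orc i a ?x" by simp
    also have "\<dots> \<le> count orc i a x" using \<open>?x \<le> x\<close> by (rule count_mono)
    finally show "n \<le> count orc i a x" .
  qed
  let ?Z = "\<lambda>i j. set (list_decode (orc Sparsity [i, j, c + 2]))"
  have "\<forall>\<^sub>F x in sequentially. \<forall>i\<in>{..<d}.
     (\<forall>j\<in>{..<d}. \<forall>z\<in>?Z i j. Suc (fst (prod_decode z)) \<le> count orc i 0 x)
   \<and> fst (prod_decode (orc Procyclicity [i, fact c])) \<le> count orc i 0 x
   \<and> snd (prod_decode (orc Procyclicity [i, fact c])) \<le> x"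
    by (intro eventually_ball_finite ballI eventually_conj ev eventually_ge_at_top) auto
  then obtain x0 where x0: "\<And>x i. x0 \<le> x \<Longrightarrow> i < d \<Longrightarrow>
     (\<forall>j<d. \<forall>z\<in>?Z i j. Suc (fst (prod_decode z)) \<le> count orc i 0 x)
   \<and> fst (prod_decode (orc Procyclicity [i, fact c])) \<le> count orc i 0 x
   \<and> snd (prod_decode (orc Procyclicity [i, fact c])) \<le> x"
    unfolding eventually_sequentially Ball_def lessThan_iff by blast
  have "infinite (P 0)" using infinite_P d_pos by simp
  then obtain x where x: "x \<in> P 0" "x0 \<le> x" by (metis infinite_nat_iff_unbounded_le)
  \<comment> \<open>An element in the \<open>c\<close> positions from \<open>X\<close> on would be
    at distance at most \<open>c\<close> from \<open>x\<close>, so the sparsity answer for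
    \<open>c + 2\<close> would contain the index of \<open>x\<close>, which the choice of
    \<open>x0\<close> excludes.\<close>
  define X where "X = Suc x"
  have gap: "n \<notin> P i" if "i < d" "X \<le> n" "n < X + c" for i n
  proof
    assume "n \<in> P i"
    with that have "\<exists>z\<in>?Z 0 i. fst (prod_decode z) = count orc 0 0 x"
      using d_pos x by (intro sparse_gap[of 0 i x n "c + 2"]) (auto simp: X_def)
    moreover have "\<forall>z\<in>?Z 0 i. Suc (fst (prod_decode z)) \<le> count orc 0 0 x"
      using x0[OF x(2), of 0] d_pos that(1) by (meson less_le_trans zero_less_one)
    ultimately show False by (metis Suc_n_not_le_n)
  qed
  have "\<forall>\<^sub>F y in sequentially. \<forall>i\<in>{..<d}. fact X \<le> count orc i X y"
    using ev by (intro eventually_ball_finite) auto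
  then obtain Y where "\<forall>i<d. fact X \<le> count orc i X Y"
    unfolding eventually_sequentially by (metis lessThan_iff order_refl)
  moreover have "x0 \<le> X" using x by (simp add: X_def)
  ultimately have "admissible orc d c X Y"
    unfolding admissible_def using x0[of X] gap by (simp add: Suc_le_eq)
  then show ?thesis by blast
qed

end

section \<open>Nonzero letters from \<open>X\<close> on and the gaps between them\<close>

locale admissible_setting = setting +
  fixes X Y :: nat
  assumes adm: "admissible orc d c X Y"
begin

lemma adm_sparse:
  "i < d \<Longrightarrow> j < d \<Longrightarrow> z \<in> set (list_decode (orc Sparsity [i, j, c + 2]))
    \<Longrightarrow> fst (prod_decode z) < count orc i 0 X"
  and adm_zeros: "i < d \<Longrightarrow> X \<le> n \<Longrightarrow> n < X + c \<Longrightarrow> n \<notin> P i"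
  and adm_threshold: "i < d \<Longrightarrow> fst (pc i (fact c)) \<le> count orc i 0 X"
  and adm_period: "i < d \<Longrightarrow> snd (pc i (fact c)) \<le> X"
  and adm_many: "i < d \<Longrightarrow> fact X \<le> count orc i X Y"
proof -
  show "fst (prod_decode z) < count orc i 0 X"
    if "i < d" "j < d" "z \<in> set (list_decode (orc Sparsity [i, j, c + 2]))"
    using adm that unfolding admissible_def by blast
qed (use adm in \<open>auto simp: admissible_def\<close>)

abbreviation "n0 \<equiv> skipped orc d X"

definition pos :: "nat \<Rightarrow> nat" where
  "pos j = enumerate support (n0 + j)"

text \<open>The moments at which the two runs are compared: \<open>X\<close> at first, then just
  after each nonzero letter. Block \<open>j\<close> starts at \<open>time j\<close>, consists of
  zeros and is closed by the letter at \<open>pos j\<close>.\<close>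

definition time :: "nat \<Rightarrow> nat" where
  "time j = (case j of 0 \<Rightarrow> X | Suc j \<Rightarrow> Suc (pos j))"

lemma time_0: "time 0 = X" and time_Suc: "time (Suc j) = Suc (pos j)"
  by (simp_all add: time_def)

lemma pos_support: "pos j \<in> support"
  unfolding pos_def by (rule enumerate_in_set[OF infinite_support])

lemma time_ge: "X \<le> time j"
  and time_le_pos: "time j \<le> pos j"
proof -
  have X: "X \<le> pos j" for j
    unfolding pos_def le_enumerate_iff[OF infinite_support] by (simp add: skipped_eq)
  then show "X \<le> time j" by (cases j) (auto simp: time_0 time_Suc le_Suc_eq)
  show "time j \<le> pos j"
  proof (cases j)
    case (Suc k)
    then show ?thesis
      using enumerate_step[OF infinite_support, of "n0 + k"] by (simp add: time_Suc pos_def Suc_le_eq)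
  qed (simp add: time_0 X)
qed

text \<open>Its index would be at least \<open>n0\<close> and less than \<open>n0 + j\<close>, so it
  would be one of the earlier letters, all of which lie before \<open>time j\<close>.\<close>

lemma no_letter_between:
  assumes "time j \<le> n" "n < pos j" shows "n \<notin> support"
proof
  assume n: "n \<in> support"
  then obtain k where k: "n = enumerate support k" using enumerate_Ex[OF infinite_support] by metis
  with assms(2) have k_less: "k < n0 + j"
    by (simp add: pos_def enumerate_mono_iff[OF infinite_support])
  have "n0 \<le> k"
    using assms(1) time_ge[of j] le_enumerate_iff[OF infinite_support, of X k] k by (simp add: skipped_eq)
  with k_less obtain j' where j': "j = Suc j'" "k \<le> n0 + j'" by (cases j) auto
  with k have "n \<le> pos j'" by (simp add: pos_def enumerate_mono_le_iff[OF infinite_support])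
  with assms(1) j' show False by (simp add: time_Suc)
qed

text \<open>The first gap is due to the zeros from \<open>X\<close> on. A later short gap would put
  the index of the preceding letter among the sparsity answers, all of which are smaller than the
  index of any element from \<open>X\<close> on.\<close>

lemma gap: "time j + c \<le> pos j"
proof (cases j)
  case 0
  obtain i where "i < d" "pos 0 \<in> P i" using pos_support mem_support_iff by blast
  with adm_zeros[of i "pos 0"] time_ge[of 0] time_le_pos[of 0] 0 show ?thesis
    by (force simp: time_0)
next
  case (Suc k)
  obtain i i' where i: "i < d" "pos k \<in> P i" and i': "i' < d" "pos j \<in> P i'"
    using pos_support mem_support_iff by meson
  show ?thesis
  proof (rule ccontr)
    assume "\<not> time j + c \<le> pos j"
    with Suc have "pos j < pos k + (c + 2)" by (simp add: time_Suc)
    moreover have "pos k < pos j" using time_le_pos[of j] Suc by (simp add: time_Suc)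
    ultimately obtain z where "z \<in> set (list_decode (orc Sparsity [i, i', c + 2]))"
      "fst (prod_decode z) = count orc i 0 (pos k)"
      using sparse_gap[OF i(1) i'(1) i(2) i'(2)] by blast
    with adm_sparse[OF i(1) i'(1)] have "count orc i 0 (pos k) < count orc i 0 X" by metis
    moreover have "X \<le> pos k" using time_ge[of k] time_le_pos[of k] by simp
    ultimately show False using count_mono[of X "pos k" i 0] by simp
  qed
qed

lemma run_in_gap:
  "g \<le> pos j - time j \<Longrightarrow> dma_run A \<alpha> (time j + g) = (zstep ^^ g) (dma_run A \<alpha> (time j))"
proof (induction g)
  case (Suc g)
  then have "time j + g \<notin> support" by (intro no_letter_between[of j]) auto
  then have "\<alpha> (time j + g) = replicate d False" by (simp add: support_def)
  with Suc show ?case by (simp add: zstep_def[of "(zstep ^^ g) _"])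
qed simp

lemma run_time_Suc:
  "dma_run A \<alpha> (time (Suc j)) = delta A ((zstep ^^ (pos j - time j)) (dma_run A \<alpha> (time j))) (\<alpha> (pos j))"
  using run_in_gap[of "pos j - time j" j] time_le_pos[of j] by (simp add: time_Suc)

lemma count_pos: "i < d \<Longrightarrow> count orc i X (pos j) = count orc i X (time j)"
proof -
  assume "i < d"
  then have "{n \<in> P i. time j \<le> n \<and> n < pos j} = {}"
    using no_letter_between[of j] mem_support_iff by blast
  then have "count orc i (time j) (pos j) = 0" by (simp add: count_eq)
  then show ?thesis using count_split[OF time_ge time_le_pos] by simp
qed

section \<open>Residues of positions modulo \<open>c!\<close>\<close>

text \<open>The period is positive and at most \<open>X\<close>, hence divides \<open>X!\<close>,
  and the elements before \<open>X\<close> are numerous enough to pass the threshold.\<close>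

lemma enumerate_cong:
  assumes "i < d"
  shows "[enumerate (P i) (count orc i 0 X + k) = enumerate (P i) (count orc i 0 X + k mod fact X)] (mod fact c)"
proof -
  obtain N p where Np: "pc i (fact c) = (N, p)" by fastforce
  have p: "1 \<le> p" and per: "[enumerate (P i) (n + p) = enumerate (P i) n] (mod fact c)" if "N \<le> n" for n
    using pc_data assms Np that fact_ge_1[of c] unfolding procyclicity_data_def by fastforce+
  have mult: "[enumerate (P i) (n + l * p) = enumerate (P i) n] (mod fact c)" if "N \<le> n" for n l
  proof (induction l)
    case (Suc l)
    have "[enumerate (P i) (n + l * p + p) = enumerate (P i) (n + l * p)] (mod fact c)"
      using that by (intro per) simp
    then have "[enumerate (P i) (n + l * p + p) = enumerate (P i) n] (mod fact c)"
      using Suc by (rule cong_trans)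
    then show ?case by (simp add: ac_simps)
  qed simp
  have N: "N \<le> count orc i 0 X" and "p \<le> X"
    using adm_threshold[OF assms] adm_period[OF assms] Np by auto
  then have "p dvd fact X" using p[OF N] by (intro dvd_fact) auto
  then obtain l where l: "fact X = p * l" by blast
  let ?n = "count orc i 0 X + k mod fact X"
  have "k = k mod fact X + (k div fact X * l) * p"
    using mod_mult_div_eq[of k "fact X"] unfolding l by (simp add: ac_simps)
  then have eq: "?n + (k div fact X * l) * p = count orc i 0 X + k" by linarith
  have "[enumerate (P i) (?n + (k div fact X * l) * p) = enumerate (P i) ?n] (mod fact c)"
    using N by (intro mult) simp
  then show ?thesis unfolding eq .
qed

text \<open>At least \<open>X!\<close> elements of \<open>P i\<close> lie between \<open>X\<close>
  and \<open>Y\<close>, so the search for one with a smaller counter value succeeds before its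
  cut-off.\<close>

lemma position_eq:
  assumes "i < d" "k < fact X"
  shows "position orc X Y i k = enumerate (P i) (count orc i 0 X + k)"
    and "enumerate (P i) (count orc i 0 X + k) < Y"
proof -
  let ?y = "enumerate (P i) (count orc i 0 X + k)"
  have inf: "infinite (P i)" using infinite_P assms by blast
  have Xy: "X \<le> ?y" unfolding le_enumerate_iff[OF inf] by (simp add: count_0_eq)
  have "count orc i 0 ?y = count orc i 0 X + k"
    by (simp add: count_0_eq card_less_enumerate[OF inf])
  then have cnt: "count orc i X ?y = k" using count_split[of 0 X ?y i] Xy by simp
  show less: "?y < Y"
  proof (rule ccontr)
    assume "\<not> ?y < Y"
    then have "count orc i X Y \<le> k" using cnt count_mono[of Y ?y i X] by simp
    with adm_many[OF assms(1)] assms(2) show False by simp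
  qed
  show "position orc X Y i k = ?y"
    unfolding position_def
  proof (rule Least_equality)
    show "Y \<le> ?y \<or> X \<le> ?y \<and> orc Membership [i, ?y] = 1 \<and> count orc i X ?y = k"
      using Xy cnt enumerate_in_set[OF inf] by simp
    fix y assume "Y \<le> y \<or> X \<le> y \<and> orc Membership [i, y] = 1 \<and> count orc i X y = k"
    then consider "Y \<le> y" | "X \<le> y" "y \<in> P i" "count orc i X y = k"
      by (auto simp: of_bool_def split: if_splits)
    then show "?y \<le> y"
    proof cases
      case 2
      then have "count orc i 0 y = count orc i 0 X + k" using count_split[of 0 X y i] by simp
      then show ?thesis using enumerate_card_less[OF inf 2(2)] by (simp add: count_0_eq)
    qed (use less in simp)
  qed
qed

text \<open>Nothing is counted between \<open>time j\<close> and \<open>pos j\<close>, so the count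
  at \<open>time j\<close> is the index of \<open>pos j\<close> relative to \<open>X\<close>;
  reducing it modulo \<open>X!\<close> does not change the residue of the element.\<close>

lemma position_cong:
  assumes "i < d" "pos j \<in> P i"
  shows "[position orc X Y i (count orc i X (time j) mod fact X) = pos j] (mod fact c)"
proof -
  have "X \<le> pos j" using time_ge[of j] time_le_pos[of j] by simp
  then have "count orc i 0 (pos j) = count orc i 0 X + count orc i X (time j)"
    using count_split[of 0 X "pos j" i] count_pos[OF assms(1)] by simp
  then have "enumerate (P i) (count orc i 0 X + count orc i X (time j)) = pos j"
    using enumerate_card_less[OF infinite_P[OF assms(1)] assms(2)] by (simp add: count_0_eq)
  then show ?thesis
    using enumerate_cong[OF assms(1), of "count orc i X (time j)"] position_eq(1)[OF assms(1)]
    by (simp add: cong_sym_eq)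
qed

lemma track_support:
  assumes "n \<in> support"
  shows "track d (letter_code (\<alpha> n)) < d" "n \<in> P (track d (letter_code (\<alpha> n)))"
proof -
  have lnth: "lnth (letter_code (\<alpha> n)) i = of_bool (n \<in> P i)" if "i < d" for i
    using that lnth_letter_code[of i "\<alpha> n"] by (simp add: char_word_def)
  obtain i where i: "i < d" "n \<in> P i" using assms mem_support_iff by blast
  then have le: "track d (letter_code (\<alpha> n)) \<le> i"
    unfolding track_def by (intro Least_le) (simp add: lnth)
  with i show less: "track d (letter_code (\<alpha> n)) < d" by simp
  have "track d (letter_code (\<alpha> n)) \<ge> d \<or> lnth (letter_code (\<alpha> n)) (track d (letter_code (\<alpha> n))) = 1"
    unfolding track_def by (rule LeastI[of _ d]) simp
  with less show "n \<in> P (track d (letter_code (\<alpha> n)))" by (auto simp: lnth of_bool_def split: if_splits)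
qed

text \<open>The exponent in \<open>advance\<close> and the true number of zeros are congruent modulo
  \<open>c!\<close>, and both are at least \<open>c\<close>, the latter by
  \<open>gap\<close>.\<close>

lemma advance_eq:
  assumes "[r = time j] (mod fact c)" "[y = pos j] (mod fact c)"
  shows "advance d c (dma_run A \<alpha> (time j)) r y (letter_code (\<alpha> (pos j))) = dma_run A \<alpha> (time (Suc j))"
proof -
  let ?q = "dma_run A \<alpha> (time j)"
  let ?g = "y + fact c * (r + c) - r"
  \<comment> \<open>As \<open>c!\<close> is at least 1, the subtraction of \<open>r\<close> is not
    truncated.\<close>
  have ge: "r + c \<le> fact c * (r + c)" using fact_ge_1[of c, where 'a = nat] by (simp del: fact_ge_1)
  then have g_ge: "c \<le> ?g" by linarith
  have "r \<le> y + fact c * (r + c)" using ge by linarith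
  then have "?g + r = y + fact c * (r + c)" by (rule le_add_diff_inverse2)
  then have "[?g + r = y] (mod fact c)" by (simp add: cong_def)
  also have "[y = (pos j - time j) + time j] (mod fact c)" using assms(2) time_le_pos[of j] by simp
  also have "[(pos j - time j) + time j = (pos j - time j) + r] (mod fact c)"
    using assms(1) by (intro cong_add) (auto simp: cong_sym_eq)
  finally have "[?g = pos j - time j] (mod fact c)" by (simp add: cong_add_rcancel_nat)
  then have "(zstep ^^ ?g) ?q = (zstep ^^ (pos j - time j)) ?q"
    using g_ge gap[of j]
    by (intro funpow_cong_fact[OF zstep_states finite_states card_states run_states]) auto
  then show ?thesis
    unfolding advance_def run_time_Suc idle_eq[OF run_states]
    by (simp add: fetch_eq funpow_zstep_states run_states char_word_bitvecs)
qed

section \<open>The automaton \<open>B\<close> and its code\<close>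

abbreviation "zmax \<equiv> top_state orc d c X Y"

definition visits :: "nat \<Rightarrow> nat \<Rightarrow> bool" where
  "visits s a \<longleftrightarrow> (\<exists>g\<le>c. idle d c g (lnth s 1) = a)"

text \<open>The cut at \<open>zmax\<close> closes the state set under all transitions; on the run
  over the order word it never takes effect. Comparison below \<open>c\<close> covers all states of
  \<open>A\<close>.\<close>

definition B :: "(nat, bool list) dma" where
  "B = \<lparr>states = {..zmax}, init = min (start_state orc d c X) zmax,
     delta = (\<lambda>s b. min (step orc d c X Y s (letter_code b)) zmax),
     acc = {S. S \<subseteq> {..zmax} \<and> (\<exists>F\<in>acc A. \<forall>a<c. a \<in> F \<longleftrightarrow> (\<exists>s\<in>S. visits s a))}\<rparr>"

lemma B_simps:
  "states B = {..zmax}" "init B = min (start_state orc d c X) zmax"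
  "delta B s b = min (step orc d c X Y s (letter_code b)) zmax"
  "acc B = {S. S \<subseteq> {..zmax} \<and> (\<exists>F\<in>acc A. \<forall>a<c. a \<in> F \<longleftrightarrow> (\<exists>s\<in>S. visits s a))}"
  by (simp_all add: B_def)

lemma B_over: "dma_over (bitvecs d) B"
  by (auto simp: dma_over_def B_simps)

text \<open>By monotonicity of the codes, the bounded listings in \<open>table\<close> and
  \<open>final_sets\<close> are exhaustive.\<close>

lemma B_code: "presents d (result_code orc d c (prod_encode (X, Y))) B"
proof -
  let ?ks = "filter (\<lambda>k. fst (prod_decode k) \<le> zmax \<and> is_letter d (snd (prod_decode k)))
    [0..<Suc (prod_encode (zmax, list_encode (map (\<lambda>i. 1) [0..<d])))]"
  let ?bits = "\<lambda>l. map (\<lambda>i. lnth l i = 1) [0..<d]"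
  let ?t = "\<lambda>k. (fst (prod_decode k), ?bits (snd (prod_decode k)),
    delta B (fst (prod_decode k)) (?bits (snd (prod_decode k))))"
  let ?xs = "filter (\<lambda>x. (\<forall>s\<in>set (list_decode x). s \<le> zmax) \<and> accepting d c x)
    [0..<Suc (list_encode [0..<Suc zmax])]"
  have ts: "set (map ?t ?ks) = {(q, b, delta B q b) | q b. q \<in> states B \<and> b \<in> bitvecs d}"
  proof (intro equalityI subsetI)
    fix x assume "x \<in> {(q, b, delta B q b) | q b. q \<in> states B \<and> b \<in> bitvecs d}"
    then obtain q b where x: "x = (q, b, delta B q b)" and q: "q \<le> zmax" and b: "b \<in> bitvecs d"
      by (auto simp: B_simps)
    have "?bits (letter_code b) = b"
      using is_letter_imp[OF is_letter_letter_code[OF b]] by (simp only: letter_code_inject)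
    moreover have "prod_encode (q, letter_code b) \<le> prod_encode (zmax, list_encode (map (\<lambda>i. 1) [0..<d]))"
      using q letter_code_le[OF b] by (rule prod_encode_mono)
    ultimately show "x \<in> set (map ?t ?ks)"
      using q is_letter_letter_code[OF b] x
      by (auto intro!: image_eqI[of _ _ "prod_encode (q, letter_code b)"] simp del: upt_Suc)
  qed (auto simp: bitvecs_def B_simps simp del: upt_Suc)
  have table: "table orc d c X Y
      = list_encode (map (\<lambda>(q, b, q'). list_encode [q, letter_code b, q']) (map ?t ?ks))"
    unfolding table_def map_map
    by (rule arg_cong[where f = list_encode], rule map_cong) (auto simp: is_letter_imp[simplified] B_simps simp del: upt_Suc)
  have accepting: "accepting d c x \<longleftrightarrow> (\<exists>F\<in>acc A. \<forall>a<c. a \<in> F \<longleftrightarrow> (\<exists>s\<in>set (list_decode x). visits s a))" for x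
    unfolding accepting_def acc_code[symmetric] visits_def by auto
  have Fs: "set ` set (map list_decode ?xs) = acc B"
  proof (intro equalityI subsetI)
    fix S assume S: "S \<in> acc B"
    \<comment> \<open>Among the codes of \<open>S\<close> the increasing list is chosen: as a
      sublist of the list of all states it lies in the range searched.\<close>
    define x where "x = list_encode (filter (\<lambda>s. s \<in> S) [0..<Suc zmax])"
    have "set (list_decode x) = S" using S by (auto simp: x_def B_simps less_Suc_eq_le simp del: upt_Suc)
    moreover have "x \<le> list_encode [0..<Suc zmax]"
      unfolding x_def by (rule list_encode_filter_le)
    ultimately have "x \<in> set ?xs"
      using S by (auto simp: accepting B_simps simp del: upt_Suc)
    with \<open>set (list_decode x) = S\<close> show "S \<in> set ` set (map list_decode ?xs)"
      unfolding set_map by blast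
  qed (auto simp: accepting B_simps simp del: upt_Suc)
  show ?thesis
    unfolding presents_def
  proof (intro exI conjI)
    show "set [0..<Suc zmax] = states B" by (auto simp: B_simps)
    show "result_code orc d c (prod_encode (X, Y)) = list_encode [list_encode [0..<Suc zmax], init B,
        list_encode (map (\<lambda>(q, b, q'). list_encode [q, letter_code b, q']) (map ?t ?ks)),
        list_encode (map list_encode (map list_decode ?xs))]"
      unfolding table[symmetric]
      by (simp add: result_code_def B_simps final_sets_def comp_def del: upt_Suc list_encode.simps)
  qed (rule ts Fs)+
qed

section \<open>Simulation of \<open>A\<close> along the order word\<close>

lemma state_le_top:
  assumes "t \<le> n0" "q \<in> states A" "r \<le> X + Suc Y" "\<And>i. i < d \<Longrightarrow> v i \<le> fact X"
  shows "list_encode [t, q, r, list_encode (map v [0..<d])] \<le> zmax"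
  unfolding top_state_def
  using assms states_less[OF assms(2)]
  by (auto intro!: list_encode_mono simp: list_all2_conv_all_nth simp del: list_encode.simps)

lemma run_B_initial:
  "j \<le> n0 \<Longrightarrow> dma_run B \<beta> j = list_encode [j, dma_run A \<alpha> X, X, list_encode (map (\<lambda>i. 0) [0..<d])]"
proof (induction j)
  case 0
  have "start_state orc d c X \<le> zmax"
    unfolding start_state_def run_at_eq zero_code_def by (rule state_le_top) (auto simp: run_states)
  then show ?case by (simp add: B_simps start_state_def run_at_eq zero_code_def del: list_encode.simps)
next
  case (Suc j)
  let ?s = "\<lambda>j. list_encode [j, dma_run A \<alpha> X, X, list_encode (map (\<lambda>i. 0) [0..<d])]"
  have "step orc d c X Y (?s j) l = ?s (Suc j)" for l
    using Suc.prems by (simp add: step_def lnth_list_encode del: list_encode.simps)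
  moreover have "?s (Suc j) \<le> zmax" using Suc.prems by (intro state_le_top) (auto simp: run_states)
  ultimately show ?case using Suc by (simp add: B_simps del: list_encode.simps)
qed

text \<open>The true time is unbounded, so the state holds only a representative \<open>r\<close> of
  it modulo \<open>c!\<close>; the bound on \<open>r\<close> is what keeps the state below
  \<open>zmax\<close>.\<close>

lemma run_B_simulates:
  "\<exists>r. [r = time j] (mod fact c) \<and> r \<le> X + Suc Y \<and> dma_run B \<beta> (n0 + j) = list_encode
     [n0, dma_run A \<alpha> (time j), r, list_encode (map (\<lambda>i. count orc i X (time j) mod fact X) [0..<d])]"
proof (induction j)
  case 0
  have "count orc i X X = 0" for i by (simp add: count_def)
  then show ?case
    using run_B_initial[of n0] by (intro exI[of _ X]) (simp add: time_0)
next
  case (Suc j)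
  let ?v = "\<lambda>j i. count orc i X (time j) mod fact X"
  obtain r where r: "[r = time j] (mod fact c)" "r \<le> X + Suc Y"
    and run: "dma_run B \<beta> (n0 + j) = list_encode [n0, dma_run A \<alpha> (time j), r, list_encode (map (?v j) [0..<d])]"
    using Suc by blast
  let ?l = "letter_code (\<alpha> (pos j))"
  define i where "i = track d ?l"
  have i: "i < d" "pos j \<in> P i" using track_support[OF pos_support[of j]] by (simp_all add: i_def)
  define y where "y = position orc X Y i (?v j i)"
  have y: "[y = pos j] (mod fact c)" unfolding y_def by (rule position_cong[OF i])
  have "y < Y" unfolding y_def using position_eq[OF i(1), of "?v j i"] by simp
  \<comment> \<open>Adding the bits of the letter counts the elements at \<open>pos j\<close>, one
    for each predicate that contains it.\<close>
  have v: "map (\<lambda>i. (lnth (list_encode (map (?v j) [0..<d])) i + lnth ?l i) mod fact X) [0..<d]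
      = map (?v (Suc j)) [0..<d]"
  proof (rule map_cong[OF refl])
    fix k assume "k \<in> set [0..<d]"
    then have k: "k < d" by simp
    have "count orc k X (time (Suc j)) = count orc k X (time j) + of_bool (pos j \<in> P k)"
      using count_Suc[of X "pos j" k] time_ge[of j] time_le_pos[of j] count_pos[OF k]
      by (simp add: time_Suc)
    moreover have "lnth ?l k = of_bool (pos j \<in> P k)"
      using k lnth_letter_code[of k "\<alpha> (pos j)"] by (simp add: char_word_def)
    ultimately show "(lnth (list_encode (map (?v j) [0..<d])) k + lnth ?l k) mod fact X = ?v (Suc j) k"
      using k by (simp add: lnth_list_encode mod_add_left_eq)
  qed
  have "step orc d c X Y (dma_run B \<beta> (n0 + j)) ?l
      = list_encode [n0, dma_run A \<alpha> (time (Suc j)), Suc y, list_encode (map (?v (Suc j)) [0..<d])]"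
    using i(1) unfolding run step_def v[symmetric] advance_eq[OF r(1) y, symmetric]
    by (simp add: lnth_list_encode Let_def i_def[symmetric] y_def[symmetric] del: list_encode.simps)
  moreover have "list_encode [n0, dma_run A \<alpha> (time (Suc j)), Suc y, list_encode (map (?v (Suc j)) [0..<d])] \<le> zmax"
    using \<open>y < Y\<close> by (intro state_le_top) (auto simp: run_states less_imp_le)
  moreover have "\<beta> (n0 + j) = \<alpha> (pos j)" by (simp add: order_word_eq pos_def)
  ultimately have "dma_run B \<beta> (n0 + Suc j)
      = list_encode [n0, dma_run A \<alpha> (time (Suc j)), Suc y, list_encode (map (?v (Suc j)) [0..<d])]"
    by (simp add: B_simps del: list_encode.simps)
  moreover have "[Suc y = time (Suc j)] (mod fact c)"
    unfolding time_Suc using cong_add[OF y cong_refl[of 1]] by simp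
  ultimately show ?case using \<open>y < Y\<close> by (intro exI[of _ "Suc y"]) simp
qed

section \<open>States visited infinitely often\<close>

text \<open>Within block \<open>j\<close> the states of \<open>A\<close> are iterates of the zero
  step. By \<open>gap\<close> all exponents up to \<open>c\<close> occur, and larger ones give no
  further states.\<close>

lemma visits_run_B_iff:
  "visits (dma_run B \<beta> (n0 + j)) a \<longleftrightarrow> (\<exists>n. time j \<le> n \<and> n < time (Suc j) \<and> dma_run A \<alpha> n = a)"
proof -
  let ?q = "dma_run A \<alpha> (time j)"
  have q: "lnth (dma_run B \<beta> (n0 + j)) 1 = ?q"
    using run_B_simulates[of j] by (auto simp: lnth_list_encode simp del: list_encode.simps)
  have "visits (dma_run B \<beta> (n0 + j)) a \<longleftrightarrow> (\<exists>g\<le>c. (zstep ^^ g) ?q = a)"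
    unfolding visits_def q by (simp add: idle_eq[OF run_states])
  also have "\<dots> \<longleftrightarrow> (\<exists>g\<le>pos j - time j. (zstep ^^ g) ?q = a)"
  proof safe
    fix g assume "g \<le> c"
    then show "\<exists>g'\<le>pos j - time j. (zstep ^^ g') ?q = (zstep ^^ g) ?q"
      using gap[of j] by (intro exI[of _ g]) auto
  next
    fix g
    have "\<exists>h\<le>c. (zstep ^^ g) ?q = (zstep ^^ h) ?q"
      by (rule funpow_bounded_exponent[OF zstep_states finite_states card_states run_states])
    then obtain h where "h \<le> c" "(zstep ^^ g) ?q = (zstep ^^ h) ?q" by blast
    then show "\<exists>g'\<le>c. (zstep ^^ g') ?q = (zstep ^^ g) ?q"
      by (intro exI[of _ h]) simp
  qed
  also have "\<dots> \<longleftrightarrow> (\<exists>g\<le>pos j - time j. dma_run A \<alpha> (time j + g) = a)"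
    by (auto simp: run_in_gap)
  also have "\<dots> \<longleftrightarrow> (\<exists>n. time j \<le> n \<and> n < time (Suc j) \<and> dma_run A \<alpha> n = a)"
  proof safe
    fix g assume "g \<le> pos j - time j"
    then show "\<exists>n. time j \<le> n \<and> n < time (Suc j) \<and> dma_run A \<alpha> n = dma_run A \<alpha> (time j + g)"
      using time_le_pos[of j] by (intro exI[of _ "time j + g"]) (auto simp: time_Suc)
  next
    fix n assume "time j \<le> n" "n < time (Suc j)"
    then show "\<exists>g\<le>pos j - time j. dma_run A \<alpha> (time j + g) = dma_run A \<alpha> n"
      by (intro exI[of _ "n - time j"]) (auto simp: time_Suc)
  qed
  finally show ?thesis .
qed

lemma time_less: "time j < time (Suc j)"
  using time_le_pos[of j] by (simp add: time_Suc)

lemma le_time: "j \<le> time j"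
proof (induction j)
  case (Suc j)
  then show ?case using time_less[of j] by simp
qed simp

lemma time_interval:
  assumes "time J \<le> n" shows "\<exists>j\<ge>J. time j \<le> n \<and> n < time (Suc j)"
proof -
  have "\<exists>j\<ge>J. n < time (Suc j)"
    by (rule exI[of _ "J + n"]) (use le_time[of "Suc (J + n)"] in auto)
  define j where "j = (LEAST j. J \<le> j \<and> n < time (Suc j))"
  have j: "J \<le> j" "n < time (Suc j)"
    using LeastI_ex[OF \<open>\<exists>j\<ge>J. n < time (Suc j)\<close>] by (auto simp: j_def)
  have "time j \<le> n"
  proof (cases "j = J")
    case False
    then obtain k where k: "j = Suc k" "J \<le> k" using j(1) by (cases j) auto
    then have "\<not> n < time (Suc k)"
      using not_less_Least[of k "\<lambda>j. J \<le> j \<and> n < time (Suc j)"] by (auto simp: j_def)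
    with k show ?thesis by simp
  qed (use assms in simp)
  with j show ?thesis by blast
qed

lemma run_B_le: "dma_run B \<beta> n \<le> zmax"
  by (cases n) (auto simp: B_simps)

lemma limit_run_A: "a \<in> limit (dma_run A \<alpha>) \<longleftrightarrow> (\<exists>s\<in>limit (dma_run B \<beta>). visits s a)"
proof
  assume "a \<in> limit (dma_run A \<alpha>)"
  then have inf: "\<forall>N. \<exists>n\<ge>N. dma_run A \<alpha> n = a" by (simp add: limit_def INFM_nat_le)
  have "\<exists>\<^sub>\<infinity>n. \<exists>s\<in>{..zmax}. dma_run B \<beta> n = s \<and> visits s a"
    unfolding INFM_nat_le
  proof
    fix N
    obtain n where n: "time N \<le> n" "dma_run A \<alpha> n = a" using inf by blast
    then obtain j where "N \<le> j" "time j \<le> n" "n < time (Suc j)" using time_interval by blast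
    with n have "visits (dma_run B \<beta> (n0 + j)) a" using visits_run_B_iff by blast
    then show "\<exists>n\<ge>N. \<exists>s\<in>{..zmax}. dma_run B \<beta> n = s \<and> visits s a"
      using \<open>N \<le> j\<close> run_B_le by (intro exI[of _ "n0 + j"]) auto
  qed
  \<comment> \<open>Pigeonhole: \<open>B\<close> has finitely many states, so one of those whose
    orbit contains \<open>a\<close> recurs infinitely often.\<close>
  from frequently_bex_finite[OF finite_atMost this]
  obtain s where "\<exists>\<^sub>\<infinity>n. dma_run B \<beta> n = s \<and> visits s a" by blast
  then have "visits s a" "s \<in> limit (dma_run B \<beta>)"
    by (auto simp: limit_def dest: INFM_EX elim: frequently_elim1)
  then show "\<exists>s\<in>limit (dma_run B \<beta>). visits s a" by blast
next
  assume "\<exists>s\<in>limit (dma_run B \<beta>). visits s a"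
  then obtain s where s: "\<forall>N. \<exists>n\<ge>N. dma_run B \<beta> n = s" "visits s a"
    by (auto simp: limit_def INFM_nat_le)
  have "\<exists>n\<ge>N. dma_run A \<alpha> n = a" for N
  proof -
    obtain n where n: "n0 + N \<le> n" "dma_run B \<beta> n = s" using s(1) by blast
    then obtain j where j: "n = n0 + j" "N \<le> j" 
      by (intro that[of "n - n0"]) auto
    with n s(2) obtain m where "time j \<le> m" "dma_run A \<alpha> m = a" using visits_run_B_iff by blast
    then show ?thesis using j le_time[of j] by (intro exI[of _ m]) auto
  qed
  then show "a \<in> limit (dma_run A \<alpha>)" by (simp add: limit_def INFM_nat_le)
qed

text \<open>The accepting sets of \<open>A\<close> and the limit set of its run lie below
  \<open>c\<close>, so agreement below \<open>c\<close> is equality.\<close>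

lemma limit_acc_iff: "limit (dma_run A \<alpha>) \<in> acc A \<longleftrightarrow> limit (dma_run B \<beta>) \<in> acc B"
proof -
  have A: "limit (dma_run A \<alpha>) \<subseteq> {..<c}"
    using run_states states_less by (force simp: limit_def dest!: INFM_EX)
  have B: "limit (dma_run B \<beta>) \<subseteq> {..zmax}"
    using run_B_le by (force simp: limit_def dest!: INFM_EX)
  have F: "F \<subseteq> {..<c}" if "F \<in> acc A" for F
    using A_over that states_less unfolding dma_over_def by blast
  have "limit (dma_run B \<beta>) \<in> acc B \<longleftrightarrow> (\<exists>F\<in>acc A. \<forall>a<c. a \<in> F \<longleftrightarrow> a \<in> limit (dma_run A \<alpha>))"
    using B by (simp add: B_simps limit_run_A)
  also have "\<dots> \<longleftrightarrow> (\<exists>F\<in>acc A. F = limit (dma_run A \<alpha>))"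
    using A F by (intro bex_cong refl) blast
  finally show ?thesis by simp
qed

lemma B_equivalent: "\<alpha> \<in> dma_lang (bitvecs d) A \<longleftrightarrow> \<beta> \<in> dma_lang (bitvecs d) B"
  using char_word_bitvecs limit_acc_iff by (auto simp: dma_lang_def order_word_eq)

end

theorem theorem3p12:
  "\<exists>prog :: query recprog.
     \<forall>(d :: nat) (A :: (nat, bool list) dma) (c :: nat) (P :: nat \<Rightarrow> nat set) pc sp.
       d \<ge> 1 \<and> dma_over (bitvecs d) A \<and> presents d c A
       \<and> (\<forall>i<d. infinite (P i)) \<and> procyclicity_data d P pc \<and> sparsity_data d P sp
       \<longrightarrow> (\<exists>c' (B :: (nat, bool list) dma).
              computes (answer P pc sp) prog [d, c] c'
              \<and> dma_over (bitvecs d) B \<and> presents d c' B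
              \<and> (char_word d P \<in> dma_lang (bitvecs d) A
                   \<longleftrightarrow> order_word d P \<in> dma_lang (bitvecs d) B))"
proof -
  \<comment> \<open>The program is fixed before the automaton, the predicates and the oracle data
    are.\<close>
  obtain prog :: "query recprog" where prog: "\<And>orc d c. \<exists>X Y. admissible orc d c X Y \<Longrightarrow>
     \<exists>X Y. admissible orc d c X Y \<and> computes orc prog [d, c] (result_code orc d c (prod_encode (X, Y)))"
    using ex_program_result_code by blast
  show ?thesis
  proof (rule exI[of _ prog], intro allI impI)
    fix d and A :: "(nat, bool list) dma" and c P pc sp
    assume "d \<ge> 1 \<and> dma_over (bitvecs d) A \<and> presents d c A
       \<and> (\<forall>i<d. infinite (P i)) \<and> procyclicity_data d P pc \<and> sparsity_data d P sp"
    then interpret setting d A c P pc sp by unfold_locales auto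
    obtain X Y where adm: "admissible orc d c X Y"
      and comp: "computes orc prog [d, c] (result_code orc d c (prod_encode (X, Y)))"
      using prog[OF ex_admissible] by blast
    interpret admissible_setting d A c P pc sp X Y by unfold_locales (rule adm)
    show "\<exists>c' (B :: (nat, bool list) dma). computes orc prog [d, c] c'
        \<and> dma_over (bitvecs d) B \<and> presents d c' B
        \<and> (\<alpha> \<in> dma_lang (bitvecs d) A \<longleftrightarrow> \<beta> \<in> dma_lang (bitvecs d) B)"
      using comp B_over B_code B_equivalent by blast
  qed
qed

end
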